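(* Let $q\equiv 1\pmod 4$ be a prime power, let $\gamma$ be a primitive element of $\mathbb{F}_{q^2}$, and put $\delta=\gamma^{\frac{q+1}{2}}$. Let $Q(4,q)$ be the parabolic quadric, $A$ the group acting on its points, and $C_{\frac{q+1}{2}}^{(2(q+1),q^2)}\subset\mathbb{F}_{q^2}^*$ the coset that are defined in the context, and for a point $P$ of $Q(4,q)$ let $O(P)$ denote the $A$-orbit of $P$. Put $$S=\Big\{\big\langle\big(1,\,y,\,y^{-1}(w-\tfrac12)\big)\big\rangle \;\Big|\; w\in C_{\frac{q+1}{2}}^{(2(q+1),q^2)},\ y\in\mathbb{F}_{q^2}^*\Big\}$$ and $$\mathcal{M}=O(0,0,1)\cup O(1,1,-\tfrac12)\cup O(0,1,\delta)\cup S.$$ Then $\mathcal{M}$ is a $\frac{q+1}{2}$-ovoid of $Q(4,q)$.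
   Context: Let $q\equiv 1\pmod 4$ be a prime power and let $\gamma$ be a fixed primitive element of $\mathbb{F}_{q^2}$ (a generator of $\mathbb{F}_{q^2}^*$). For a positive integer $e$ dividing $q^2-1$, let $C_0^{(e,q^2)}$ be the subgroup of index $e$ of $\mathbb{F}_{q^2}^*$ and let $C_i^{(e,q^2)}=\gamma^i C_0^{(e,q^2)}$ for $0\le i\le e-1$. Let $V=\mathbb{F}_q\times\mathbb{F}_{q^2}\times\mathbb{F}_{q^2}$, viewed as a 5-dimensional vector space over $\mathbb{F}_q$, and let $f(x,y,z)=x^2+\mathrm{Tr}_{q^2/q}(yz)$, where $\mathrm{Tr}_{q^2/q}(t)=t+t^q$ is the trace from $\mathbb{F}_{q^2}$ to $\mathbb{F}_q$; $f$ is a non-degenerate quadratic form on $V$. The projective space $\mathrm{PG}(4,q)$ is that of $V$; its points are the one-dimensional $\mathbb{F}_q$-subspaces $\langle (x,y,z)\rangle$, also written simply $(x,y,z)$. The points of the parabolic quadric $Q(4,q)$ are $$Q(4,q)=\{\langle (x,y,z)\rangle\mid 0\neq (x,y,z)\in V,\ f(x,y,z)=0\},$$ and the lines of $Q(4,q)$ are the lines of $\mathrm{PG}(4,q)$ all of whose points lie in this set. For a positive integer $m$, an $m$-ovoid of $Q(4,q)$ is a set of points of $Q(4,q)$ that meets every line of $Q(4,q)$ in exactly $m$ points. The group $A$ is the group of projective linear transformations of $\mathrm{PG}(4,q)$, preserving $Q(4,q)$, generated by the maps $T_u:(x,y,z)\mapsto (x,yu,zu^{-1})$ for $u\in C_0^{(2,q^2)}$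 (the nonzero squares of $\mathbb{F}_{q^2}$), together with the two involutions $\sigma:(x,y,z)\mapsto (x,y^q,z^q)$ and $\tau:(x,y,z)\mapsto (x,z,y)$. *)

theory Defs
  imports
    "HOL-Algebra.Generated_Groups"
    "HOL-Algebra.Bij"
    "HOL-Algebra.Multiplicative_Group"
    "HOL-Algebra.Algebraic_Closure_Type"
    "HOL-Number_Theory.Prime_Powers"
    "HOL-Library.Product_Plus"
    "HOL-Library.Cardinality"
begin

text \<open>
  Throughout, \<open>'a\<close> is a finite field with \<open>q\<^sup>2\<close> elements and \<open>\<bbbF>\<^sub>q\<close> is its subfield of order \<open>q\<close>.
  As \<open>\<bbbF>\<^sub>q\<close> is a subset of \<open>'a\<close> and not a type, the notions of projective geometry
  over \<open>\<bbbF>\<^sub>q\<close> are written out relative to that subset.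
\<close>

definition Fq :: "nat \<Rightarrow> 'a::field set" where
  "Fq q = {x. x ^ q = x}"

definition units_group :: "'a::field monoid" where
  "units_group = \<lparr>carrier = UNIV - {0}, monoid.mult = (*), one = 1\<rparr>"

definition primitive_elt :: "'a::field \<Rightarrow> bool" where
  "primitive_elt g \<longleftrightarrow> g \<in> carrier units_group \<and> generate units_group {g} = carrier units_group"

lemma units_group_simps [simp]:
  "carrier units_group = (UNIV - {0} :: 'a::field set)"
  "monoid.mult units_group = ((*) :: 'a \<Rightarrow> 'a \<Rightarrow> 'a)"
  "monoid.one units_group = (1 :: 'a)"
  by (simp_all add: units_group_def)

lemma units_group_eq_mult_of:
  "units_group = Multiplicative_Group.mult_of (ring_of_type_algebra :: 'a::field ring)"
  by (simp add: units_group_def Multiplicative_Group.mult_of_def ring_of_type_algebra_def)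

lemma units_group_group: "group (units_group :: 'a::field monoid)"
  unfolding units_group_eq_mult_of
  by (rule field.field_mult_group[OF field_from_type_algebra])

lemma units_group_pow: "x [^]\<^bsub>(units_group :: 'a::field monoid)\<^esub> (n::nat) = x ^ n"
proof -
  interpret G: group "units_group :: 'a monoid" by (rule units_group_group)
  show ?thesis by (induction n) (simp_all add: mult.commute)
qed

lemma card_roots_of_unity_le:
  assumes "d > 0"
  shows "card {x::'a::{field,finite}. x ^ d = 1} \<le> d"
proof -
  let ?p = "Polynomial.monom 1 d - 1 :: 'a poly"
  have c: "Polynomial.coeff ?p d = 1" using assms by (simp add: coeff_1)
  have nz: "?p \<noteq> 0" using c by (metis coeff_0 zero_neq_one)
  have "Polynomial.degree ?p \<le> d" by (intro degree_diff_le) (simp_all add: degree_monom_le)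
  moreover have "{x::'a. x ^ d = 1} = {x. poly ?p x = 0}" by (simp add: poly_monom)
  moreover have "card {x. poly ?p x = 0} \<le> Polynomial.degree ?p"
    using nz by (rule card_poly_roots_bound)
  ultimately show ?thesis by simp
qed

lemma ex1_subgroup_index:
  fixes e :: nat
  assumes e: "e dvd CARD('a::{field,finite}) - 1"
  shows "\<exists>!H :: 'a set. subgroup H units_group \<and> card (rcosets\<^bsub>units_group\<^esub> H) = e"
proof -
  let ?G = "units_group :: 'a monoid"
  interpret G: group ?G by (rule units_group_group)
  define N where "N = CARD('a) - 1"
  have ordG: "Coset.order ?G = N" by (simp add: Coset.order_def N_def card_Diff_singleton)
  have fin: "finite (carrier ?G)" by simp
  have N0: "N > 0" using ordG G.order_gt_0_iff_finite fin by metis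
  obtain d where d: "N = e * d" using e unfolding N_def by auto
  have d0: "d > 0" and e0: "e > 0" using N0 d by auto
  define R where "R = {x::'a. x ^ d = 1}"
  have leR: "card R \<le> d" unfolding R_def by (rule card_roots_of_unity_le[OF d0])
  have uniq: "H = R" if H: "subgroup H ?G" and i: "card (rcosets\<^bsub>?G\<^esub> H) = e" for H
  proof -
    have "e * card H = e * d" using G.lagrange[OF H] i ordG d by simp
    hence cH: "card H = d" using e0 by simp
    interpret K: group "?G\<lparr>carrier := H\<rparr>" by (rule G.subgroup_imp_group[OF H])
    have "x ^ d = 1" if "x \<in> H" for x
    proof -
      have "x [^]\<^bsub>?G\<lparr>carrier := H\<rparr>\<^esub> Coset.order (?G\<lparr>carrier := H\<rparr>) = \<one>\<^bsub>?G\<lparr>carrier := H\<rparr>\<^esub>"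
        using that by (intro K.pow_order_eq_1) simp
      thus ?thesis
        using G.nat_pow_consistent[of x d H] units_group_pow[of x d] cH
        by (simp add: Coset.order_def)
    qed
    hence "H \<subseteq> R" by (auto simp: R_def)
    thus ?thesis using leR cH by (intro card_seteq) auto
  qed
  have sub: "subgroup R ?G"
  proof
    show "R \<subseteq> carrier ?G" using d0 by (auto simp: R_def power_0_left)
  next
    fix x assume x: "x \<in> R"
    hence xG: "x \<in> carrier ?G" using d0 by (auto simp: R_def power_0_left)
    have "inv\<^bsub>?G\<^esub> x * x = 1" using G.l_inv[OF xG] by simp
    hence "(inv\<^bsub>?G\<^esub> x) ^ d * x ^ d = 1" by (metis power_mult_distrib power_one)
    thus "inv\<^bsub>?G\<^esub> x \<in> R" using x by (simp add: R_def)
  qed (auto simp: R_def power_mult_distrib)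
  obtain a where a: "a \<in> carrier ?G" "carrier ?G = {a [^]\<^bsub>?G\<^esub> i | i::nat. i \<in> UNIV}"
  proof -
    have "field (ring_of_type_algebra :: 'a ring)" by (rule field_from_type_algebra)
    moreover have "finite (carrier (ring_of_type_algebra :: 'a ring))" by simp
    ultimately have "\<exists>a\<in>carrier ?G. carrier ?G = {a [^]\<^bsub>ring_of_type_algebra\<^esub> i | i::nat. i \<in> UNIV}"
      unfolding units_group_eq_mult_of by (rule field.finite_field_mult_group_has_gen)
    moreover have "a [^]\<^bsub>ring_of_type_algebra\<^esub> i = a [^]\<^bsub>?G\<^esub> i" for a and i :: nat
      unfolding units_group_eq_mult_of by (simp add: Multiplicative_Group.nat_pow_mult_of)
    ultimately show thesis using that by auto
  qed
  have "generate ?G {a} = carrier ?G"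
    using G.generate_pow_on_finite_carrier[OF fin a(1)] a(2) by auto
  hence "G.ord a = N"
    using G.generate_pow_card[OF a(1)] ordG by (simp add: Coset.order_def)
  hence inj: "inj_on (\<lambda>i. a ^ i) {0..N - 1}"
    using G.ord_inj[OF a(1)] by (simp add: units_group_pow)
  have aN: "a ^ N = 1" using G.pow_order_eq_1[OF a(1)] ordG by (simp add: units_group_pow)
  have "inj_on (\<lambda>i. a ^ (e * i)) {..<d}"
  proof (rule inj_onI)
    fix i j assume ij: "i \<in> {..<d}" "j \<in> {..<d}" "a ^ (e * i) = a ^ (e * j)"
    have "e * i < N" "e * j < N" using ij e0 d by auto
    hence "e * i \<in> {0..N - 1}" "e * j \<in> {0..N - 1}" by simp_all
    hence "e * i = e * j" using inj_onD[OF inj ij(3)] by blast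
    thus "i = j" using e0 by simp
  qed
  moreover have "(\<lambda>i. a ^ (e * i)) ` {..<d} \<subseteq> R"
  proof (clarsimp simp: R_def)
    fix i
    have "(a ^ (e * i)) ^ d = (a ^ N) ^ i" by (simp add: d mult_ac flip: power_mult)
    thus "(a ^ (e * i)) ^ d = 1" using aN by simp
  qed
  ultimately have "d \<le> card R" using card_inj_on_le[of _ "{..<d}" R] by simp
  hence "card R = d" using leR by simp
  hence "card (rcosets\<^bsub>?G\<^esub> R) = e" using G.lagrange[OF sub] ordG d d0 by simp
  thus ?thesis using sub uniq by blast
qed

text \<open>
  The subgroup of index \<open>e\<close>; by the preceding lemma the description is well posed
  whenever \<open>e\<close> divides the order of the multiplicative group.
\<close>

definition C0 :: "nat \<Rightarrow> 'a::{field,finite} set" where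
  "C0 e = (THE H. subgroup H units_group \<and> card (rcosets\<^bsub>units_group\<^esub> H) = e)"

definition cyc_class :: "'a \<Rightarrow> nat \<Rightarrow> nat \<Rightarrow> 'a::{field,finite} set" where
  "cyc_class \<gamma> e i = (\<lambda>c. \<gamma> ^ i * c) ` C0 e"

definition Vsp :: "nat \<Rightarrow> ('a::field \<times> 'a \<times> 'a) set" where
  "Vsp q = Fq q \<times> UNIV \<times> UNIV"

fun scale :: "'a \<Rightarrow> 'a \<times> 'a \<times> 'a \<Rightarrow> 'a::field \<times> 'a \<times> 'a" where
  "scale c (x, y, z) = (c * x, c * y, c * z)"

definition Tr :: "nat \<Rightarrow> 'a \<Rightarrow> 'a::field" where
  "Tr q t = t + t ^ q"

fun qform :: "nat \<Rightarrow> 'a \<times> 'a \<times> 'a \<Rightarrow> 'a::field" where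
  "qform q (x, y, z) = x ^ 2 + Tr q (y * z)"

definition pt :: "nat \<Rightarrow> 'a \<times> 'a \<times> 'a \<Rightarrow> ('a::field \<times> 'a \<times> 'a) set" where
  "pt q v = {scale c v | c. c \<in> Fq q}"

definition PG_points :: "nat \<Rightarrow> ('a::field \<times> 'a \<times> 'a) set set" where
  "PG_points q = {pt q v | v. v \<in> Vsp q \<and> v \<noteq> 0}"

definition lin_indep2 :: "nat \<Rightarrow> 'a \<times> 'a \<times> 'a \<Rightarrow> 'a::field \<times> 'a \<times> 'a \<Rightarrow> bool" where
  "lin_indep2 q u v \<longleftrightarrow>
    (\<forall>a\<in>Fq q. \<forall>b\<in>Fq q. scale a u + scale b v = 0 \<longrightarrow> a = 0 \<and> b = 0)"

definition span2 :: "nat \<Rightarrow> 'a \<times> 'a \<times> 'a \<Rightarrow> 'a \<times> 'a \<times> 'a \<Rightarrow> ('a::field \<times> 'a \<times> 'a) set" where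
  "span2 q u v = {scale a u + scale b v | a b. a \<in> Fq q \<and> b \<in> Fq q}"

text \<open>A line is represented by the set of points on it.\<close>

definition PG_lines :: "nat \<Rightarrow> ('a::field \<times> 'a \<times> 'a) set set set" where
  "PG_lines q = {{P \<in> PG_points q. P \<subseteq> span2 q u v} | u v.
                  u \<in> Vsp q \<and> v \<in> Vsp q \<and> lin_indep2 q u v}"

definition Q_points :: "nat \<Rightarrow> ('a::field \<times> 'a \<times> 'a) set set" where
  "Q_points q = {pt q v | v. v \<in> Vsp q \<and> v \<noteq> 0 \<and> qform q v = 0}"

definition Q_lines :: "nat \<Rightarrow> ('a::field \<times> 'a \<times> 'a) set set set" where
  "Q_lines q = {l \<in> PG_lines q. l \<subseteq> Q_points q}"

definition m_ovoid :: "nat \<Rightarrow> nat \<Rightarrow> ('a::field \<times> 'a \<times> 'a) set set \<Rightarrow> bool" where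
  "m_ovoid q m M \<longleftrightarrow> m > 0 \<and> M \<subseteq> Q_points q \<and> (\<forall>l\<in>Q_lines q. card (M \<inter> l) = m)"

fun T_map :: "'a \<Rightarrow> 'a \<times> 'a \<times> 'a \<Rightarrow> 'a::field \<times> 'a \<times> 'a" where
  "T_map u (x, y, z) = (x, y * u, z * inverse u)"

fun sigma_map :: "nat \<Rightarrow> 'a \<times> 'a \<times> 'a \<Rightarrow> 'a::field \<times> 'a \<times> 'a" where
  "sigma_map q (x, y, z) = (x, y ^ q, z ^ q)"

fun tau_map :: "'a \<times> 'a \<times> 'a \<Rightarrow> 'a::field \<times> 'a \<times> 'a" where
  "tau_map (x, y, z) = (x, z, y)"

text \<open>
  The permutation of the points induced by a linear bijection \<open>g\<close> of \<open>Vsp q\<close>. It is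
  restricted to the set of points because \<open>BijGroup\<close> consists of extensional functions.
\<close>

definition induced ::
  "nat \<Rightarrow> ('a \<times> 'a \<times> 'a \<Rightarrow> 'a \<times> 'a \<times> 'a) \<Rightarrow> ('a::field \<times> 'a \<times> 'a) set \<Rightarrow> ('a \<times> 'a \<times> 'a) set" where
  "induced q g = (\<lambda>P \<in> PG_points q. g ` P)"

definition A_group ::
  "nat \<Rightarrow> (('a::{field,finite} \<times> 'a \<times> 'a) set \<Rightarrow> ('a \<times> 'a \<times> 'a) set) set" where
  "A_group q = generate (BijGroup (PG_points q))
     ({induced q (T_map u) | u. u \<in> C0 2} \<union> {induced q (sigma_map q), induced q tau_map})"

definition A_orbit ::
  "nat \<Rightarrow> 'a \<times> 'a \<times> 'a \<Rightarrow> ('a::{field,finite} \<times> 'a \<times> 'a) set set" where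
  "A_orbit q v = {g (pt q v) | g. g \<in> A_group q}"

definition S_set :: "nat \<Rightarrow> 'a \<Rightarrow> ('a::{field,finite} \<times> 'a \<times> 'a) set set" where
  "S_set q \<gamma> = {pt q (1, y, inverse y * (w - 1 / 2)) | w y.
                  w \<in> cyc_class \<gamma> (2 * (q + 1)) ((q + 1) div 2) \<and> y \<noteq> 0}"

end

theory Submission
  imports Defs "HOL-Number_Theory.Residues"
begin

text \<open>
  On a singular vector \<open>(x, y, z)\<close> we have \<open>yz = - x\<^sup>2/2 + \<delta>s\<close> with \<open>s \<in> \<bbbF>\<^sub>q\<close>, because
  \<open>\<delta>\<^sup>q = - \<delta>\<close>. Let \<open>\<chi>\<close> be the quadratic character of \<open>s\<close> in \<open>\<bbbF>\<^sub>q\<close> if \<open>s \<noteq> 0\<close>, and otherwise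
  the quadratic character in \<open>\<bbbF>\<^sub>q\<^sub>2\<close> of a nonzero one of \<open>y\<close> and \<open>z\<close>. Then \<open>\<M>\<close> consists of
  the points with \<open>\<chi> = 1\<close>, so it suffices that \<open>\<chi>\<close> takes both values equally often on every line
  of the quadric; this is shown by an injection of the line's nonzero vectors that negates \<open>\<chi>\<close>.

  The restriction of \<open>s\<close> to a line is a binary quadratic form over \<open>\<bbbF>\<^sub>q\<close>. If it is anisotropic,
  it is a multiple of \<open>X\<^sup>2 - dY\<^sup>2\<close> with \<open>d\<close> a nonsquare, and \<open>(X, Y) \<mapsto> (dY, X)\<close> multiplies it
  by \<open>- d\<close>, a nonsquare since \<open>q \<equiv> 1 (mod 4)\<close>. If it is hyperbolic, \<open>s = rab\<close> in a suitable basis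
  of zeros \<open>P, R\<close>, and the identity \<open>(yx' - y'x)\<^sup>2 = - 2\<delta>ryy'\<close> with \<open>\<delta>\<close> a nonsquare
  shows that \<open>\<chi>\<close> takes opposite values at \<open>P\<close> and \<open>R\<close>. The only degenerate lines are
  \<open>x = y = 0\<close> and \<open>x = z = 0\<close>.
\<close>

lemma C0_eq_roots_of_unity:
  fixes e d :: nat
  assumes ed: "e * d = CARD('a::{field,finite}) - 1"
  shows "C0 e = {x::'a. x ^ d = 1}" and "card (C0 e :: 'a set) = d"
proof -
  let ?G = "units_group :: 'a monoid"
  interpret G: group ?G by (rule units_group_group)
  have "e dvd CARD('a) - 1" using ed by (metis dvd_triv_left)
  from theI'[OF ex1_subgroup_index[OF this]]
  have H: "subgroup (C0 e) ?G" and i: "card (rcosets\<^bsub>?G\<^esub> (C0 e)) = e"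
    unfolding C0_def by blast+
  have ordG: "Coset.order ?G = e * d"
    using ed by (simp add: Coset.order_def card_Diff_singleton)
  have fin: "finite (carrier ?G)" by simp
  have "e * d > 0" using ordG G.order_gt_0_iff_finite fin by metis
  hence e0: "e > 0" and d0: "d > 0" by auto
  have "card (C0 e :: 'a set) * e = e * d" using G.lagrange[OF H] i ordG by (simp add: mult.commute)
  thus c: "card (C0 e :: 'a set) = d" using e0 by simp
  interpret K: group "?G\<lparr>carrier := C0 e\<rparr>" by (rule G.subgroup_imp_group[OF H])
  have "x ^ d = 1" if "x \<in> C0 e" for x :: 'a
  proof -
    have "x [^]\<^bsub>?G\<lparr>carrier := C0 e\<rparr>\<^esub> Coset.order (?G\<lparr>carrier := C0 e\<rparr>) = \<one>\<^bsub>?G\<lparr>carrier := C0 e\<rparr>\<^esub>"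
      using that by (intro K.pow_order_eq_1) simp
    thus ?thesis
      using G.nat_pow_consistent[of x d "C0 e"] units_group_pow[of x d] c
      by (simp add: Coset.order_def)
  qed
  hence "C0 e \<subseteq> {x::'a. x ^ d = 1}" by auto
  thus "C0 e = {x::'a. x ^ d = 1}"
    using card_roots_of_unity_le[OF d0, where 'a = 'a] c by (intro card_seteq) auto
qed

lemma nonzero_power_card_eq_1:
  fixes x :: "'a::{field,finite}"
  assumes "x \<noteq> 0"
  shows "x ^ (CARD('a) - 1) = 1"
proof -
  interpret G: group "units_group :: 'a monoid" by (rule units_group_group)
  have "x [^]\<^bsub>units_group\<^esub> Coset.order (units_group :: 'a monoid) = \<one>\<^bsub>units_group\<^esub>"
    using assms by (intro G.pow_order_eq_1) simp
  thus ?thesis by (simp add: units_group_pow Coset.order_def card_Diff_singleton)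
qed

lemma primitive_elt_power_eq_1_iff:
  fixes g :: "'a::{field,finite}"
  assumes "primitive_elt g"
  shows "g ^ n = 1 \<longleftrightarrow> CARD('a) - 1 dvd n"
proof -
  interpret G: group "units_group :: 'a monoid" by (rule units_group_group)
  have g: "g \<in> carrier units_group" "generate units_group {g} = carrier units_group"
    using assms unfolding primitive_elt_def by blast+
  have "G.ord g = CARD('a) - 1"
    using G.generate_pow_card[OF g(1)] g(2) by (simp add: card_Diff_singleton)
  thus ?thesis using G.pow_eq_id[OF g(1), of n] by (simp add: units_group_pow)
qed

lemma primitive_elt_generates:
  fixes g :: "'a::{field,finite}"
  assumes "primitive_elt g" and "x \<noteq> 0"
  obtains i :: nat where "x = g ^ i"
proof -
  interpret G: group "units_group :: 'a monoid" by (rule units_group_group)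
  have g: "g \<in> carrier units_group" "generate units_group {g} = carrier units_group"
    using assms(1) unfolding primitive_elt_def by blast+
  have "x \<in> generate units_group {g}" using g(2) assms(2) by simp
  also have "generate units_group {g} = {g [^]\<^bsub>units_group\<^esub> i | i::nat. i \<in> UNIV}"
    by (rule G.generate_pow_on_finite_carrier[OF _ g(1)]) simp
  finally show thesis using that by (auto simp: units_group_pow)
qed

lemma card_half_of_swap:
  fixes f :: "'b \<Rightarrow> 'c::{ring_1}" and \<phi> :: "'b \<Rightarrow> 'b"
  assumes fin: "finite W" and vals: "\<And>w. w \<in> W \<Longrightarrow> f w = 1 \<or> f w = - 1"
    and ne: "(1::'c) \<noteq> - 1"
    and inj: "inj_on \<phi> W" and into: "\<phi> ` W \<subseteq> W"
    and swap: "\<And>w. w \<in> W \<Longrightarrow> f (\<phi> w) = - f w"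
  shows "2 * card {w \<in> W. f w = 1} = card W"
proof -
  let ?A = "{w \<in> W. f w = 1}" and ?B = "{w \<in> W. f w = - 1}"
  have "W = ?A \<union> ?B" "?A \<inter> ?B = {}" using vals ne by auto
  hence "card W = card ?A + card ?B" using fin by (metis (no_types, lifting) card_Un_disjoint finite_Un)
  moreover have "card ?A \<le> card ?B"
    by (rule card_inj_on_le[of \<phi>]) (use inj into swap fin in \<open>auto intro: inj_on_subset\<close>)
  moreover have "card ?B \<le> card ?A"
    by (rule card_inj_on_le[of \<phi>]) (use inj into swap fin in \<open>auto intro: inj_on_subset\<close>)
  ultimately show ?thesis by simp
qed

lemma subgroup_BijGroup_stabilizer:
  assumes Y: "Y \<subseteq> S" and fin: "finite Y"
  shows "subgroup {f \<in> Bij S. f ` Y \<subseteq> Y} (BijGroup S)"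
proof (rule group.subgroupI[OF group_BijGroup])
  show "{f \<in> Bij S. f ` Y \<subseteq> Y} \<subseteq> carrier (BijGroup S)" by (auto simp: BijGroup_def)
  have "(\<lambda>x\<in>S. x) \<in> {f \<in> Bij S. f ` Y \<subseteq> Y}" using Y by (auto simp: id_Bij)
  thus "{f \<in> Bij S. f ` Y \<subseteq> Y} \<noteq> {}" by blast
next
  fix f assume f: "f \<in> {f \<in> Bij S. f ` Y \<subseteq> Y}"
  hence B: "f \<in> Bij S" and inj: "inj_on f S" by (auto simp: Bij_def bij_betw_def)
  have "f ` Y = Y" using endo_inj_surj[OF fin] f inj_on_subset[OF inj Y] by blast
  hence "inv_into S f ` Y = Y" using inv_into_image_cancel[OF inj Y] by simp
  moreover have "(\<lambda>x\<in>S. inv_into S f x) ` Y = inv_into S f ` Y"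
    by (rule image_cong) (use Y in auto)
  ultimately have "(\<lambda>x\<in>S. inv_into S f x) ` Y = Y" by simp
  thus "inv\<^bsub>BijGroup S\<^esub> f \<in> {f \<in> Bij S. f ` Y \<subseteq> Y}"
    using B by (simp add: inv_BijGroup restrict_inv_into_Bij)
next
  fix f g assume fg: "f \<in> {f \<in> Bij S. f ` Y \<subseteq> Y}" "g \<in> {f \<in> Bij S. f ` Y \<subseteq> Y}"
  hence "compose S f g ` Y \<subseteq> Y" using Y by (auto simp: compose_def subset_eq)
  thus "f \<otimes>\<^bsub>BijGroup S\<^esub> g \<in> {f \<in> Bij S. f ` Y \<subseteq> Y}"
    using fg by (simp add: BijGroup_def compose_Bij)
qed

locale quadric_setting =
  fixes q :: nat and \<gamma> :: "'a::{field,finite}"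
  assumes primepow_q: "primepow q" and q_mod_4: "q mod 4 = 1"
    and card_K: "CARD('a) = q ^ 2" and primitive: "primitive_elt \<gamma>"
begin

definition \<delta> :: 'a where "\<delta> = \<gamma> ^ ((q + 1) div 2)"

definition etaK :: "'a \<Rightarrow> 'a" where "etaK x = x ^ ((q ^ 2 - 1) div 2)"

definition etaF :: "'a \<Rightarrow> 'a" where "etaF x = x ^ ((q - 1) div 2)"

lemma q_form: obtains k where "q = 4 * k + 1" and "k > 0"
proof -
  have "q = 4 * (q div 4) + 1" using q_mod_4 by presburger
  moreover have "q \<noteq> 1" using primepow_q by auto
  ultimately show thesis using that[of "q div 4"] by linarith
qed

lemma q_gt_0: "q > 0"
  by (rule q_form) simp

lemma half_order: "0 < (q ^ 2 - 1) div 2" "(q ^ 2 - 1) div 2 < q ^ 2 - 1"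
proof -
  obtain k where k: "q = 4 * k + 1" "k > 0" by (rule q_form)
  have "q ^ 2 - 1 = 2 * (8 * k * k + 4 * k)" by (simp add: k power2_eq_square algebra_simps)
  thus "0 < (q ^ 2 - 1) div 2" "(q ^ 2 - 1) div 2 < q ^ 2 - 1" using k(2) by simp_all
qed

lemma frobenius_add: "(x + y) ^ q = x ^ q + y ^ q" for x y :: 'a
proof -
  obtain p n where p: "prime p" "q = p ^ n" using primepow_q unfolding primepow_def by blast
  have "prime CHAR('a)" by (rule prime_CHAR_semidom) (simp add: finite_imp_CHAR_pos)
  moreover have "CHAR('a) dvd (p ^ n) ^ 2" using CHAR_dvd_CARD[where 'a = 'a] card_K p(2) by simp
  ultimately have "CHAR('a) = p"
    using p(1) by (metis prime_dvd_power primes_dvd_imp_eq)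
  thus ?thesis using freshmans_dream'[of q n x y] p by simp
qed

lemma frobenius_minus: "(- x) ^ q = - (x ^ q)" for x :: 'a
  using frobenius_add[of x "- x"] q_gt_0 by (simp add: add_eq_0_iff2 power_0_left)

lemma frobenius_diff: "(x - y) ^ q = x ^ q - y ^ q" for x y :: 'a
  using frobenius_add[of x "- y"] frobenius_minus[of y] by simp

lemma pow_q2: "x \<noteq> 0 \<Longrightarrow> x ^ (q ^ 2 - 1) = 1" for x :: 'a
  using nonzero_power_card_eq_1[of x] card_K by simp

lemma gamma_pow_eq_1_iff: "\<gamma> ^ n = 1 \<longleftrightarrow> q ^ 2 - 1 dvd n"
  using primitive_elt_power_eq_1_iff[OF primitive] card_K by simp

lemma gamma_nz: "\<gamma> \<noteq> 0"
  using primitive unfolding primitive_elt_def by simp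

lemma two_nz [simp]: "(2::'a) \<noteq> 0"
proof
  assume two: "(2::'a) = 0"
  obtain k where k: "q = 4 * k + 1" by (rule q_form)
  have m: "(- 1 :: 'a) = 1" using two by (metis add_eq_0_iff one_add_one)
  have "\<gamma> ^ ((q ^ 2 - 1) div 2) * \<gamma> ^ ((q ^ 2 - 1) div 2) = \<gamma> ^ (q ^ 2 - 1)"
    unfolding power_add[symmetric] by (rule arg_cong[where f = "power \<gamma>"])
      (simp add: k power2_eq_square algebra_simps)
  also have "\<dots> = 1" using pow_q2[OF gamma_nz] .
  finally have "\<gamma> ^ ((q ^ 2 - 1) div 2) = 1" using m square_eq_1_iff by metis
  hence "q ^ 2 - 1 dvd (q ^ 2 - 1) div 2" using gamma_pow_eq_1_iff by simp
  thus False using half_order dvd_imp_le by (meson not_less)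
qed

lemma four_nz [simp]: "(4::'a) \<noteq> 0"
proof -
  have "(4::'a) = 2 * 2" by simp
  thus ?thesis using two_nz mult_eq_0_iff by metis
qed

lemma one_neq_minus_one [simp]: "(1::'a) \<noteq> - 1" "(- 1::'a) \<noteq> 1"
  using two_nz by (metis add.right_inverse one_add_one)+

lemma etaK_mult: "etaK (x * y) = etaK x * etaK y"
  by (simp add: etaK_def power_mult_distrib)

lemma etaF_mult: "etaF (x * y) = etaF x * etaF y"
  by (simp add: etaF_def power_mult_distrib)

lemma etaK_sq: assumes "x \<noteq> 0" shows "etaK x * etaK x = 1"
proof -
  obtain k where k: "q = 4 * k + 1" by (rule q_form)
  have "etaK x * etaK x = x ^ (q ^ 2 - 1)"
    unfolding etaK_def power_add[symmetric] by (rule arg_cong[where f = "power x"])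
      (simp add: k power2_eq_square algebra_simps)
  thus ?thesis using pow_q2[OF assms] by simp
qed

lemma etaK_cases: "x \<noteq> 0 \<Longrightarrow> etaK x = 1 \<or> etaK x = - 1"
  using etaK_sq square_eq_1_iff by blast

lemma etaK_0_iff [simp]: "etaK x = 0 \<longleftrightarrow> x = 0"
  using half_order by (simp add: etaK_def)

lemma etaF_0_iff [simp]: "etaF x = 0 \<longleftrightarrow> x = 0"
proof -
  have "0 < (q - 1) div 2" by (rule q_form) auto
  thus ?thesis by (simp add: etaF_def)
qed

lemma mem_Fq: "x \<in> Fq q \<longleftrightarrow> x ^ q = x"
  by (simp add: Fq_def)

lemma Fq_closed [intro, simp]:
  "0 \<in> Fq q" "1 \<in> Fq q"
  "x \<in> Fq q \<Longrightarrow> y \<in> Fq q \<Longrightarrow> x + y \<in> Fq q"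
  "x \<in> Fq q \<Longrightarrow> y \<in> Fq q \<Longrightarrow> x - y \<in> Fq q"
  "x \<in> Fq q \<Longrightarrow> y \<in> Fq q \<Longrightarrow> x * y \<in> Fq q"
  "x \<in> Fq q \<Longrightarrow> y \<in> Fq q \<Longrightarrow> x / y \<in> Fq q"
  "x \<in> Fq q \<Longrightarrow> - x \<in> Fq q"
  "x \<in> Fq q \<Longrightarrow> inverse x \<in> Fq q"
  "x \<in> Fq q \<Longrightarrow> x ^ n \<in> Fq q"
  for x y :: 'a
proof -
  show "x ^ n \<in> Fq q" if "x \<in> Fq q"
    using that unfolding mem_Fq by (metis mult.commute power_mult)
qed (use q_gt_0 in \<open>simp_all add: mem_Fq frobenius_add frobenius_diff frobenius_minus
       power_mult_distrib power_divide power_inverse\<close>)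

lemma two_Fq [simp]: "(2::'a) \<in> Fq q"
  using Fq_closed(3)[OF Fq_closed(2,2)] by simp

lemma Fq_units: "x \<noteq> 0 \<Longrightarrow> x \<in> Fq q \<longleftrightarrow> x ^ (q - 1) = 1" for x :: 'a
  unfolding mem_Fq using q_gt_0 power_minus_mult[of q x] by auto

lemma card_Fq_units: "card (Fq q - {0} :: 'a set) = q - 1"
proof -
  have "(q + 1) * (q - 1) = CARD('a) - 1"
    unfolding card_K by (simp add: power2_eq_square algebra_simps)
  from C0_eq_roots_of_unity[OF this] have "card {x::'a. x ^ (q - 1) = 1} = q - 1" by simp
  moreover have "q - 1 > 0" by (rule q_form) auto
  hence "x \<noteq> 0" if "x ^ (q - 1) = 1" for x :: 'a using that by (auto simp: power_0_left)
  hence "{x::'a. x ^ (q - 1) = 1} = Fq q - {0}" using Fq_units by blast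
  ultimately show ?thesis by simp
qed

lemma card_Fq: "card (Fq q :: 'a set) = q"
proof -
  have "insert 0 (Fq q - {0}) = (Fq q :: 'a set)" by auto
  moreover have "card (insert 0 (Fq q - {0 :: 'a})) = Suc (q - 1)"
    using card_Fq_units by (subst card.insert_remove) auto
  ultimately show ?thesis using q_gt_0 by simp
qed

lemma etaK_Fq: assumes "x \<in> Fq q" "x \<noteq> 0" shows "etaK x = 1"
proof -
  obtain k where k: "q = 4 * k + 1" by (rule q_form)
  have "etaK x = (x ^ (q - 1)) ^ ((q + 1) div 2)"
    unfolding etaK_def power_mult[symmetric] by (rule arg_cong[where f = "power x"])
      (simp add: k power2_eq_square algebra_simps)
  thus ?thesis using assms Fq_units by simp
qed

lemma etaF_sq: assumes "x \<in> Fq q" "x \<noteq> 0" shows "etaF x * etaF x = 1"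
proof -
  obtain k where k: "q = 4 * k + 1" by (rule q_form)
  have "etaF x * etaF x = x ^ (q - 1)"
    unfolding etaF_def power_add[symmetric] by (rule arg_cong[where f = "power x"])
      (simp add: k)
  thus ?thesis using assms Fq_units by simp
qed

lemma etaF_cases: "x \<in> Fq q \<Longrightarrow> x \<noteq> 0 \<Longrightarrow> etaF x = 1 \<or> etaF x = - 1"
  using etaF_sq square_eq_1_iff by blast

lemma etaF_minus: "etaF (- x) = etaF x"
proof -
  obtain k where k: "q = 4 * k + 1" by (rule q_form)
  have "even ((q - 1) div 2)" by (simp add: k)
  thus ?thesis by (simp add: etaF_def)
qed

lemma etaF_square: "x \<in> Fq q \<Longrightarrow> x \<noteq> 0 \<Longrightarrow> etaF (x * x) = 1"
  using etaF_sq etaF_mult by simp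

lemma etaF_sqrt:
  assumes x: "x \<in> Fq q" and e: "etaF x = 1"
  obtains c where "c \<in> Fq q" "c \<noteq> 0" "x = c * c"
proof -
  obtain k where k: "q = 4 * k + 1" and k0: "k > 0" by (rule q_form)
  have "x \<noteq> 0" using e etaF_0_iff[of x] by fastforce
  then obtain i where i: "x = \<gamma> ^ i" using primitive_elt_generates[OF primitive] by blast
  have "etaF x = x ^ (2 * k)" unfolding etaF_def by (simp add: k)
  hence "\<gamma> ^ (i * (2 * k)) = 1" using e by (simp add: i flip: power_mult)
  hence "(2 * (q + 1)) * (2 * k) dvd i * (2 * k)"
    unfolding gamma_pow_eq_1_iff by (simp add: k power2_eq_square algebra_simps)
  moreover have "2 * k \<noteq> 0" using k0 by simp
  ultimately have "2 * (q + 1) dvd i" by (metis dvd_times_right_cancel_iff)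
  then obtain j where j: "i = 2 * (q + 1) * j" by blast
  define c where "c = \<gamma> ^ ((q + 1) * j)"
  have "c ^ (q - 1) = (\<gamma> ^ (q ^ 2 - 1)) ^ j"
    unfolding c_def power_mult[symmetric] by (rule arg_cong[where f = "power \<gamma>"])
      (simp add: k power2_eq_square algebra_simps)
  hence "c ^ (q - 1) = 1" using pow_q2[OF gamma_nz] by simp
  moreover have c0: "c \<noteq> 0" using gamma_nz by (simp add: c_def)
  ultimately have "c \<in> Fq q" using Fq_units by blast
  moreover have "x = c * c" unfolding c_def i j power_add[symmetric]
    by (rule arg_cong[where f = "power \<gamma>"]) (simp add: algebra_simps)
  ultimately show thesis using that c0 by blast
qed

lemma etaK_gamma: "etaK \<gamma> = - 1"
proof -
  have "etaK \<gamma> \<noteq> 1"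
  proof
    assume "etaK \<gamma> = 1"
    hence "q ^ 2 - 1 dvd (q ^ 2 - 1) div 2" unfolding etaK_def gamma_pow_eq_1_iff .
    thus False using half_order dvd_imp_le by (meson not_less)
  qed
  thus ?thesis using etaK_cases gamma_nz by blast
qed

lemma delta_nz [simp]: "\<delta> \<noteq> 0"
  using gamma_nz by (simp add: \<delta>_def)

lemma etaK_delta: "etaK \<delta> = - 1"
proof -
  obtain k where k: "q = 4 * k + 1" by (rule q_form)
  have "etaK \<delta> = etaK \<gamma> ^ ((q + 1) div 2)"
    by (simp add: etaK_def \<delta>_def mult.commute flip: power_mult)
  have "odd ((q + 1) div 2)" by (simp add: k)
  thus ?thesis using \<open>etaK \<delta> = _\<close> by (simp add: etaK_gamma)
qed

lemma delta_frobenius: "\<delta> ^ q = - \<delta>"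
proof -
  obtain k where k: "q = 4 * k + 1" by (rule q_form)
  have "\<delta> ^ q = etaK \<gamma> * \<delta>"
    unfolding etaK_def \<delta>_def power_mult[symmetric] power_add[symmetric]
    by (rule arg_cong[where f = "power \<gamma>"]) (simp add: k power2_eq_square algebra_simps)
  thus ?thesis by (simp add: etaK_gamma)
qed

lemma nonsquare_Fq: obtains g where "g \<in> Fq q" "g \<noteq> 0" "etaF g = - 1"
proof -
  have "etaF (\<delta> * \<delta>) \<noteq> 1"
  proof
    assume "etaF (\<delta> * \<delta>) = 1"
    moreover have "\<delta> * \<delta> \<in> Fq q" by (simp add: mem_Fq power_mult_distrib delta_frobenius)
    ultimately obtain c where c: "c \<in> Fq q" "c \<noteq> 0" "\<delta> * \<delta> = c * c" by (metis etaF_sqrt)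
    hence "\<delta> = c \<or> \<delta> = - c" by (simp add: square_eq_iff)
    hence "\<delta> \<in> Fq q" using c(1) by auto
    thus False using etaK_Fq etaK_delta by fastforce
  qed
  moreover have "\<delta> * \<delta> \<in> Fq q" by (simp add: mem_Fq power_mult_distrib delta_frobenius)
  ultimately show thesis using that[of "\<delta> * \<delta>"] etaF_cases[of "\<delta> * \<delta>"] by simp
qed

subsection \<open>A sign function on singular vectors\<close>

fun sform :: "'a \<times> 'a \<times> 'a \<Rightarrow> 'a" where
  "sform (x, y, z) = (y * z + x ^ 2 / 2) / \<delta>"

fun chi :: "'a \<times> 'a \<times> 'a \<Rightarrow> 'a" where
  "chi (x, y, z) = (if sform (x, y, z) \<noteq> 0 then etaF (sform (x, y, z))
     else if y \<noteq> 0 then etaK y else etaK z)"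

definition bil :: "'a \<times> 'a \<times> 'a \<Rightarrow> 'a \<times> 'a \<times> 'a \<Rightarrow> 'a" where
  "bil u v = sform (u + v) - sform u - sform v"

definition sing :: "('a \<times> 'a \<times> 'a) set" where
  "sing = {v \<in> Vsp q. qform q v = 0}"

declare sform.simps [simp del] chi.simps [simp del]

lemma sing_iff: "(x, y, z) \<in> sing \<longleftrightarrow> x \<in> Fq q \<and> x ^ 2 + y * z + (y * z) ^ q = 0"
  by (auto simp: sing_def Vsp_def Tr_def add.assoc)

lemma qform_scale: "c \<in> Fq q \<Longrightarrow> qform q (scale c v) = c ^ 2 * qform q v" for c :: 'a
  by (cases v) (simp add: Tr_def mem_Fq power_mult_distrib power2_eq_square algebra_simps)

lemma scale_scale: "scale a (scale b v) = scale (a * b) v" for a :: 'a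
  by (cases v) (simp add: mult.assoc)

lemma scale_1 [simp]: "scale 1 v = v" for v :: "'a \<times> 'a \<times> 'a"
  by (cases v) simp

lemma scale_0 [simp]: "scale 0 v = 0" for v :: "'a \<times> 'a \<times> 'a"
  by (cases v) (simp add: zero_prod_def)

lemma scale_eq_0_iff [simp]: "scale c v = 0 \<longleftrightarrow> c = 0 \<or> v = 0" for c :: 'a
  by (cases v) (auto simp: zero_prod_def)

lemma scale_add: "scale c (u + v) = scale c u + scale c v" for c :: 'a
  by (cases u; cases v) (simp add: distrib_left)

lemma scale_add_left: "scale (c + d) v = scale c v + scale d v" for c :: 'a
  by (cases v) (simp add: distrib_right)

lemma scale_uminus_left: "scale (- c) v = - scale c v" for c :: 'a
  by (cases v) (simp)

lemma Vsp_scale: "c \<in> Fq q \<Longrightarrow> v \<in> Vsp q \<Longrightarrow> scale c v \<in> Vsp q" for c :: 'a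
  by (cases v) (simp add: Vsp_def)

lemma Vsp_add: "u \<in> Vsp q \<Longrightarrow> v \<in> Vsp q \<Longrightarrow> u + v \<in> Vsp q" for v :: "'a \<times> 'a \<times> 'a"
  by (cases u; cases v) (simp add: Vsp_def)

lemma sing_scale: "c \<in> Fq q \<Longrightarrow> v \<in> sing \<Longrightarrow> scale c v \<in> sing"
  by (simp add: sing_def Vsp_scale qform_scale)

lemma sform_scale: "sform (scale c v) = c ^ 2 * sform v"
  by (cases v) (simp add: sform.simps power2_eq_square field_simps)

lemma sform_Fq: assumes "v \<in> sing" shows "sform v \<in> Fq q"
proof -
  obtain x y z where v: "v = (x, y, z)" by (cases v)
  have x: "x \<in> Fq q" and e: "x ^ 2 + y * z + (y * z) ^ q = 0" using assms v sing_iff by auto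
  have "x ^ 2 / 2 \<in> Fq q" using x by simp
  hence "sform v ^ q = ((y * z) ^ q + x ^ 2 / 2) / - \<delta>"
    unfolding v sform.simps power_divide[of _ \<delta>] frobenius_add delta_frobenius mem_Fq by simp
  also have "\<dots> = sform v"
  proof -
    have "(y * z) ^ q = - (x ^ 2) - y * z" using e by (simp add: eq_neg_iff_add_eq_0 algebra_simps)
    hence "(y * z) ^ q + x ^ 2 / 2 = - (y * z) - (x ^ 2 - x ^ 2 / 2)" by simp
    also have "x ^ 2 - x ^ 2 / 2 = x ^ 2 / 2" by (simp add: field_simps)
    finally have "(y * z) ^ q + x ^ 2 / 2 = - (y * z + x ^ 2 / 2)" by simp
    thus ?thesis unfolding v sform.simps by (simp only: minus_divide_divide)
  qed
  finally show ?thesis by (simp add: mem_Fq)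
qed

lemma sform_eq: "y * z = \<delta> * sform (x, y, z) - x ^ 2 / 2"
  by (simp add: sform.simps)

lemma etaK_prod_cases:
  assumes "etaK (y * z) = 1" shows "etaK y = etaK z"
proof -
  have "y \<noteq> 0" "z \<noteq> 0" using assms etaK_0_iff[of "y * z"] by auto
  thus ?thesis using assms etaK_cases[of y] etaK_cases[of z] by (auto simp: etaK_mult)
qed

lemma etaK_prod_minus:
  assumes "etaK (y * z) = - 1" shows "etaK y = - etaK z"
proof -
  have "y \<noteq> 0" "z \<noteq> 0" using assms etaK_0_iff[of "y * z"] by (auto simp: neg_equal_0_iff_equal)
  thus ?thesis using assms etaK_cases[of y] etaK_cases[of z] by (auto simp: etaK_mult)
qed

lemma etaK_square: "t \<noteq> 0 \<Longrightarrow> etaK (t ^ 2) = 1"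
  using etaK_sq by (simp add: etaK_mult power2_eq_square)

lemma etaK_delta_mult: "r \<in> Fq q \<Longrightarrow> r \<noteq> 0 \<Longrightarrow> etaK (\<delta> * r) = - 1"
  by (simp add: etaK_mult etaK_delta etaK_Fq)

lemma nonsquare_of_square_eq:
  assumes "t ^ 2 = \<delta> * r * w" "r \<in> Fq q" "r \<noteq> 0" "w \<noteq> 0"
  shows "etaK w = - 1"
proof -
  have "t \<noteq> 0" using assms by auto
  hence "etaK (\<delta> * r * w) = 1" using etaK_square[of t] assms(1) by simp
  hence "etaK w * etaK (\<delta> * r) = 1" by (simp add: etaK_mult mult.commute)
  thus ?thesis using etaK_delta_mult[OF assms(2,3)] by (simp add: minus_equation_iff)
qed

lemma chi_scale:
  assumes "v \<in> sing" "c \<in> Fq q" "c \<noteq> 0" shows "chi (scale c v) = chi v"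
proof -
  obtain x y z where v: "v = (x, y, z)" by (cases v)
  have "sform (c * x, c * y, c * z) = c ^ 2 * sform v" using sform_scale[of c v] v by simp
  moreover have "etaF (c ^ 2 * sform v) = etaF (sform v)"
    using assms etaF_square[of c] by (simp add: etaF_mult power2_eq_square)
  moreover have "etaK (c * t) = etaK t" for t using assms etaK_Fq by (simp add: etaK_mult)
  ultimately show ?thesis using assms(3) by (simp add: v chi.simps)
qed

lemma chi_cases:
  assumes "v \<in> sing" "v \<noteq> 0" shows "chi v = 1 \<or> chi v = - 1"
proof -
  obtain x y z where v: "v = (x, y, z)" by (cases v)
  show ?thesis
  proof (cases "sform v = 0")
    case False
    thus ?thesis using etaF_cases[OF sform_Fq[OF assms(1)]] v by (simp add: chi.simps)
  next
    case True
    have "z \<noteq> 0" if "y = 0" using True v assms(2) that sform_eq[of y z x]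
      by (auto simp: zero_prod_def)
    thus ?thesis using True v etaK_cases[of y] etaK_cases[of z] by (auto simp: chi.simps)
  qed
qed

lemma chi_zero_z:
  assumes "(x, y, z) \<in> sing" "sform (x, y, z) = 0" "z \<noteq> 0" shows "chi (x, y, z) = etaK z"
proof (cases "y = 0")
  case False
  have "y * z = - (1 / 2) * x ^ 2" using assms(2) sform_eq[of y z x] by simp
  moreover have "- (1 / 2 :: 'a) \<in> Fq q" by simp
  moreover have "y * z \<noteq> 0" using False assms(3) by simp
  ultimately have "etaK (y * z) = 1"
    using etaK_Fq[of "y * z"] assms(1) sing_iff by (metis Fq_closed(5,9))
  hence "etaK y = etaK z" by (rule etaK_prod_cases)
  thus ?thesis using assms False by (simp add: chi.simps)
qed (use assms in \<open>simp add: chi.simps\<close>)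

lemma chi_zero_y:
  assumes "sform (x, y, z) = 0" "y \<noteq> 0" shows "chi (x, y, z) = etaK y"
  using assms by (simp add: chi.simps)

lemma bil_eq: "\<delta> * bil (x, y, z) (x', y', z') = y * z' + y' * z + x * x'"
proof -
  have "(x + x') ^ 2 / 2 = x ^ 2 / 2 + x * x' + x' ^ 2 / 2"
    by (simp add: power2_eq_square field_simps)
  hence "bil (x, y, z) (x', y', z') = (y * z' + y' * z + x * x') / \<delta>"
    unfolding bil_def add_Pair sform.simps diff_divide_distrib[symmetric]
    by (simp add: algebra_simps)
  thus ?thesis by simp
qed

lemma sform_comb:
  "sform (scale a u + scale b v) = a ^ 2 * sform u + a * b * bil u v + b ^ 2 * sform v"
proof -
  obtain x y z where u: "u = (x, y, z)" by (cases u)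
  obtain x' y' z' where v: "v = (x', y', z')" by (cases v)
  have s: "2 * \<delta> * sform (x, y, z) = 2 * (y * z) + x ^ 2" for x y z
    by (simp add: sform.simps field_simps)
  have "2 * \<delta> * (a ^ 2 * sform u + a * b * bil u v + b ^ 2 * sform v)
      = a ^ 2 * (2 * \<delta> * sform u) + 2 * (a * b * (\<delta> * bil u v)) + b ^ 2 * (2 * \<delta> * sform v)"
    by (simp add: algebra_simps)
  also have "\<dots> = a ^ 2 * (2 * (y * z) + x ^ 2) + 2 * (a * b * (y * z' + y' * z + x * x')) + b ^ 2 * (2 * (y' * z') + x' ^ 2)"
    unfolding u v s bil_eq ..
  also have "\<dots> = 2 * \<delta> * sform (scale a u + scale b v)"
    unfolding u v scale.simps add_Pair s by (simp add: power2_eq_square algebra_simps)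
  finally show ?thesis by simp
qed

lemma chi_opposite:
  assumes P: "P \<in> sing" "sform P = 0" and R: "R \<in> sing" "sform R = 0"
    and r: "bil P R \<in> Fq q" "bil P R \<noteq> 0"
  shows "chi R = - chi P"
proof -
  obtain x y z where p: "P = (x, y, z)" by (cases P)
  obtain x' y' z' where p': "R = (x', y', z')" by (cases R)
  have b: "y * z' + y' * z + x * x' = \<delta> * bil P R" using bil_eq p p' by metis
  have yz: "y * z = - (x ^ 2 / 2)" using P(2) sform_eq[of y z x] p by simp
  have yz': "y' * z' = - (x' ^ 2 / 2)" using R(2) sform_eq[of y' z' x'] p' by simp
  have nz: "\<delta> * bil P R \<noteq> 0" using r by simp
  have x: "x = 0" if "y = 0 \<or> z = 0" using yz that by auto
  have x': "x' = 0" if "y' = 0 \<or> z' = 0" using yz' that by auto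
  consider "y = 0" | "y' = 0" | "y \<noteq> 0" "y' \<noteq> 0" by blast
  thus ?thesis
  proof cases
    case 1
    hence e: "y' * z = \<delta> * bil P R" using b x by simp
    hence "etaK (y' * z) = - 1" using etaK_delta_mult r by simp
    hence "etaK y' = - etaK z" by (rule etaK_prod_minus)
    moreover have "y' \<noteq> 0" "z \<noteq> 0" using e nz by auto
    ultimately show ?thesis using chi_zero_y[of x' y' z'] chi_zero_z[of x y z] p p' P R by simp
  next
    case 2
    hence e: "y * z' = \<delta> * bil P R" using b x' by simp
    hence "etaK (y * z') = - 1" using etaK_delta_mult r by simp
    hence "etaK y = - etaK z'" by (rule etaK_prod_minus)
    moreover have "y \<noteq> 0" "z' \<noteq> 0" using e nz by auto
    ultimately show ?thesis using chi_zero_y[of x y z] chi_zero_z[of x' y' z'] p p' P R by simp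
  next
    case 3
    have "(y * x' - y' * x) ^ 2 = - 2 * (y' * y' * (- (x ^ 2 / 2)) + y * y * (- (x' ^ 2 / 2)) + x * x' * y * y')"
      by (simp add: power2_eq_square algebra_simps)
    also have "\<dots> = - 2 * (y * z' + y' * z + x * x') * (y * y')"
      unfolding yz[symmetric] yz'[symmetric] by (simp add: algebra_simps)
    also have "\<dots> = \<delta> * (- 2 * bil P R) * (y * y')" unfolding b by simp
    finally have "etaK (y * y') = - 1"
      by (rule nonsquare_of_square_eq) (use 3 r in auto)
    hence "etaK y = - etaK y'" by (rule etaK_prod_minus)
    thus ?thesis using chi_zero_y[of x y z] chi_zero_y[of x' y' z'] 3 p p' P R by simp
  qed
qed

lemma degenerate_line_axis:
  assumes P: "P \<in> sing" "sform P = 0" and Q: "Q \<in> sing" and ind: "lin_indep2 q P Q"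
    and b0: "bil P Q = 0"
  shows "(\<exists>s t. P = (0, s, 0) \<and> Q = (0, t, 0)) \<or> (\<exists>s t. P = (0, 0, s) \<and> Q = (0, 0, t))"
proof -
  obtain x y z where p: "P = (x, y, z)" by (cases P)
  obtain x' y' z' where p': "Q = (x', y', z')" by (cases Q)
  have F: "x \<in> Fq q" "x' \<in> Fq q" using P Q p p' sing_iff by auto
  have b: "y * z' + y' * z + x * x' = 0" using bil_eq[of x y z x' y' z'] b0 p p' by simp
  define s where "s = sform Q"
  have sF: "s \<in> Fq q" using sform_Fq Q s_def by simp
  have yz: "y * z = - (x ^ 2 / 2)" using P(2) sform_eq[of y z x] p by simp
  have yz': "y' * z' = \<delta> * s - x' ^ 2 / 2" using sform_eq[of y' z' x'] p' s_def by simp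
  have "(y * z' - y' * z) ^ 2 = (y * z' + y' * z) ^ 2 - 4 * (y * z) * (y' * z')"
    by (simp add: power2_eq_square algebra_simps)
  also have "y * z' + y' * z = - (x * x')" using b by (simp add: eq_neg_iff_add_eq_0)
  also have "(- (x * x')) ^ 2 - 4 * (y * z) * (y' * z') = \<delta> * (2 * x ^ 2 * s) * 1"
    unfolding yz yz' by (simp add: power2_eq_square field_simps)
  finally have disc: "(y * z' - y' * z) ^ 2 = \<delta> * (2 * x ^ 2 * s) * 1" .
  have xs: "x = 0 \<or> s = 0"
    using nonsquare_of_square_eq[OF disc] F sF by (fastforce simp: etaK_def)
  have "x = 0"
  proof (rule ccontr)
    assume x: "x \<noteq> 0"
    hence "s = 0" using xs by simp
    hence eq: "y * z' = y' * z" using disc by simp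
    have nz: "y \<noteq> 0" "z \<noteq> 0" using yz x by auto
    have e1: "2 * (y' * z) = - (x * x')" using b eq by (simp add: eq_neg_iff_add_eq_0 algebra_simps)
    have e2: "2 * (y * z) = - (x * x)" using yz by (simp add: power2_eq_square)
    have "2 * z * (x * y' - x' * y) = x * (2 * (y' * z)) - x' * (2 * (y * z))" by (simp add: algebra_simps)
    also have "\<dots> = 0" unfolding e1 e2 by simp
    finally have 1: "x * y' - x' * y = 0" using nz two_nz by simp
    have "2 * y * (x * z' - x' * z) = x * (2 * (y * z')) - x' * (2 * (y * z))" by (simp add: algebra_simps)
    also have "\<dots> = 0" unfolding eq e1 e2 by simp
    finally have 2: "x * z' - x' * z = 0" using nz two_nz by simp
    have "scale (- x') P + scale x Q = 0" using 1 2 by (simp add: p p' zero_prod_def algebra_simps)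
    hence "x = 0" using ind F unfolding lin_indep2_def by blast
    thus False using x by simp
  qed
  hence yz0: "y = 0 \<or> z = 0" using yz by simp
  have "P \<noteq> 0"
  proof
    assume "P = 0"
    hence "scale 1 P + scale 0 Q = 0" by simp
    hence "(1::'a) = 0" using ind Fq_closed(1,2) unfolding lin_indep2_def by blast
    thus False by simp
  qed
  hence "y \<noteq> 0 \<or> z \<noteq> 0" using \<open>x = 0\<close> p by (auto simp: zero_prod_def)
  have *: "x' = 0" if "y' * z' = 0"
  proof (rule ccontr)
    assume x': "x' \<noteq> 0"
    have "x' ^ 2 = \<delta> * (2 * s) * 1" using yz' that by (simp add: field_simps)
    moreover from this have "s \<noteq> 0" using x' by auto
    ultimately show False using nonsquare_of_square_eq[of x' "2 * s" 1] sF by (simp add: etaK_def)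
  qed
  show ?thesis
  proof (cases "y = 0")
    case True
    hence "z \<noteq> 0" using \<open>y \<noteq> 0 \<or> z \<noteq> 0\<close> by simp
    hence "y' = 0" using b True \<open>x = 0\<close> by simp
    thus ?thesis using * True \<open>x = 0\<close> p p' by simp
  next
    case False
    hence "z = 0" "z' = 0" using yz0 b \<open>x = 0\<close> by auto
    thus ?thesis using * \<open>x = 0\<close> p p' by simp
  qed
qed

subsection \<open>Lines of the quadric\<close>

definition comb :: "'a \<times> 'a \<times> 'a \<Rightarrow> 'a \<times> 'a \<times> 'a \<Rightarrow> 'a \<times> 'a \<Rightarrow> 'a \<times> 'a \<times> 'a" where
  "comb u v p = scale (fst p) u + scale (snd p) v"

lemma span2_eq_image: "span2 q u v = comb u v ` (Fq q \<times> Fq q)"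
  by (force simp: span2_def comb_def)

lemma comb_eq_0_iff:
  assumes "lin_indep2 q u v" "p \<in> Fq q \<times> Fq q"
  shows "comb u v p = 0 \<longleftrightarrow> p = (0, 0)"
proof
  assume "comb u v p = 0"
  hence "fst p = 0 \<and> snd p = 0"
    using assms unfolding lin_indep2_def comb_def mem_Times_iff by blast
  thus "p = (0, 0)" by (simp add: prod_eq_iff)
qed (simp add: comb_def)

lemma comb_diff: "comb u v p - comb u v p' = comb u v (p - p')"
  by (cases u; cases v) (simp add: comb_def algebra_simps)

lemma inj_on_comb:
  assumes "lin_indep2 q u v" shows "inj_on (comb u v) (Fq q \<times> Fq q)"
proof (rule inj_onI)
  fix p p' assume p: "p \<in> Fq q \<times> Fq q" "p' \<in> Fq q \<times> Fq q" "comb u v p = comb u v p'"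
  have "comb u v (p - p') = 0" using comb_diff[of u v p p'] p(3) by simp
  moreover have "p - p' \<in> Fq q \<times> Fq q" using p(1,2) by (simp add: mem_Times_iff)
  ultimately have "p - p' = (0, 0)" using comb_eq_0_iff[OF assms, of "p - p'"] by simp
  thus "p = p'" by (simp add: prod_eq_iff)
qed

lemma card_span2: "lin_indep2 q u v \<Longrightarrow> card (span2 q u v :: ('a \<times> 'a \<times> 'a) set) = q ^ 2"
  unfolding span2_eq_image
  by (simp add: card_image[OF inj_on_comb] card_cartesian_product card_Fq power2_eq_square)

lemma span2_comb:
  fixes P Q u v :: "'a \<times> 'a \<times> 'a"
  assumes "P \<in> span2 q u v" "Q \<in> span2 q u v" "c \<in> Fq q" "d \<in> Fq q"
  shows "scale c P + scale d Q \<in> span2 q u v"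
proof -
  obtain a b where P: "P = scale a u + scale b v" "a \<in> Fq q" "b \<in> Fq q"
    using assms(1) unfolding span2_def by blast
  obtain a' b' where Q: "Q = scale a' u + scale b' v" "a' \<in> Fq q" "b' \<in> Fq q"
    using assms(2) unfolding span2_def by blast
  have "scale c P + scale d Q = scale (c * a + d * a') u + scale (c * b + d * b') v"
    unfolding P(1) Q(1) by (simp add: scale_add scale_add_left scale_scale algebra_simps)
  thus ?thesis using P Q assms(3,4) unfolding span2_def by blast
qed

lemma span2_add:
  fixes P Q u v :: "'a \<times> 'a \<times> 'a"
  assumes "P \<in> span2 q u v" "Q \<in> span2 q u v" shows "P + Q \<in> span2 q u v"
  using span2_comb[OF assms Fq_closed(2,2)] by simp

lemma span2_basis: "u \<in> span2 q u v" "v \<in> span2 q u v" for u v :: "'a \<times> 'a \<times> 'a"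
proof -
  have "u = scale 1 u + scale 0 v" "v = scale 0 u + scale 1 v" by simp_all
  thus "u \<in> span2 q u v" "v \<in> span2 q u v" unfolding span2_def using Fq_closed(1,2) by blast+
qed

lemma span2_change_basis:
  fixes P Q u v :: "'a \<times> 'a \<times> 'a"
  assumes "lin_indep2 q u v" "P \<in> span2 q u v" "Q \<in> span2 q u v" "lin_indep2 q P Q"
  shows "span2 q P Q = span2 q u v"
proof (rule card_seteq)
  show "span2 q P Q \<subseteq> span2 q u v"
    using span2_comb[OF assms(2,3)] unfolding span2_def[of q P Q] by blast
  show "card (span2 q u v) \<le> card (span2 q P Q)"
    using card_span2[OF assms(1)] card_span2[OF assms(4)] by simp
qed simp

lemma lin_indep2_of_notin_pt:
  assumes "P \<noteq> 0" "Q \<notin> pt q P" shows "lin_indep2 q P (Q :: 'a \<times> 'a \<times> 'a)"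
  unfolding lin_indep2_def
proof (intro ballI impI)
  fix a b assume ab: "a \<in> Fq q" "b \<in> Fq q" "scale a P + scale b Q = 0"
  have b: "b = 0"
  proof (rule ccontr)
    assume b: "b \<noteq> 0"
    have "0 = scale (inverse b) (scale a P + scale b Q)" using ab by simp
    also have "\<dots> = scale (inverse b * a) P + Q" using b by (simp add: scale_add scale_scale)
    finally have "Q = scale (- (inverse b * a)) P"
      by (metis add_eq_0_iff scale_uminus_left)
    thus False using assms(2) ab by (auto simp: pt_def)
  qed
  thus "a = 0 \<and> b = 0" using ab assms(1) by simp
qed

lemma card_pt_le: "card (pt q v :: ('a \<times> 'a \<times> 'a) set) \<le> q"
proof -
  have "pt q v = (\<lambda>c. scale c v) ` Fq q" by (auto simp: pt_def)
  thus ?thesis using card_image_le[of "Fq q" "\<lambda>c. scale c v"] card_Fq by simp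
qed

definition positive :: "('a \<times> 'a \<times> 'a) set \<Rightarrow> ('a \<times> 'a \<times> 'a) set" where
  "positive W = {w \<in> W - {0}. chi w = 1}"

lemma card_positive_of_swap:
  assumes ind: "lin_indep2 q u v" and W: "span2 q u v \<subseteq> sing"
    and inj: "inj_on \<phi> (Fq q \<times> Fq q - {(0, 0)})"
    and into: "\<phi> ` (Fq q \<times> Fq q - {(0, 0)}) \<subseteq> Fq q \<times> Fq q - {(0, 0)}"
    and swap: "\<And>p. p \<in> Fq q \<times> Fq q - {(0, 0)} \<Longrightarrow> chi (comb u v (\<phi> p)) = - chi (comb u v p)"
  shows "2 * card (positive (span2 q u v)) = q ^ 2 - 1"
proof -
  let ?D = "Fq q \<times> Fq q - {(0, 0)} :: ('a \<times> 'a) set"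
  have im: "comb u v ` ?D = span2 q u v - {0}"
  proof (intro equalityI subsetI)
    fix w assume "w \<in> comb u v ` ?D"
    then obtain p where "p \<in> ?D" "w = comb u v p" by blast
    thus "w \<in> span2 q u v - {0}" using comb_eq_0_iff[OF ind, of p] by (simp add: span2_eq_image)
  next
    fix w assume w: "w \<in> span2 q u v - {0}"
    then obtain p where p: "p \<in> Fq q \<times> Fq q" "w = comb u v p" unfolding span2_eq_image by blast
    hence "p \<noteq> (0, 0)" using w comb_eq_0_iff[OF ind, of p] by simp
    thus "w \<in> comb u v ` ?D" using p by simp
  qed
  have "2 * card {p \<in> ?D. chi (comb u v p) = 1} = card ?D"
  proof (rule card_half_of_swap[where f = "\<lambda>p. chi (comb u v p)", OF _ _ _ inj into swap])
    fix p assume "p \<in> ?D"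
    hence "comb u v p \<in> span2 q u v - {0}" using im by blast
    thus "chi (comb u v p) = 1 \<or> chi (comb u v p) = - 1" using chi_cases W by blast
  qed simp_all
  moreover have "card ?D = q ^ 2 - 1"
    using card_Fq by (simp add: card_Diff_singleton card_cartesian_product power2_eq_square)
  moreover have "positive (span2 q u v) = comb u v ` {p \<in> ?D. chi (comb u v p) = 1}"
    unfolding positive_def im[symmetric] by blast
  moreover have "card (comb u v ` {p \<in> ?D. chi (comb u v p) = 1}) = card {p \<in> ?D. chi (comb u v p) = 1}"
    by (intro card_image inj_on_subset[OF inj_on_comb[OF ind]]) blast
  ultimately show ?thesis by simp
qed

lemma card_positive_anisotropic:
  assumes ind: "lin_indep2 q u v" and W: "span2 q u v \<subseteq> sing"
    and an: "\<And>w. w \<in> span2 q u v \<Longrightarrow> w \<noteq> 0 \<Longrightarrow> sform w \<noteq> 0"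
  shows "2 * card (positive (span2 q u v)) = q ^ 2 - 1"
proof -
  let ?D = "Fq q \<times> Fq q - {(0, 0)} :: ('a \<times> 'a) set"
  define A where "A = sform u"
  define H where "H = bil u v / 2"
  define C where "C = sform v"
  define d where "d = H ^ 2 - A * C"
  have uv: "u + v = scale 1 u + scale 1 v" by simp
  have inW: "u \<in> span2 q u v" "v \<in> span2 q u v" "u + v \<in> span2 q u v"
    using span2_basis span2_add[OF span2_basis] by blast+
  hence "bil u v \<in> Fq q" unfolding bil_def using sform_Fq W by blast
  hence F: "A \<in> Fq q" "C \<in> Fq q" "H \<in> Fq q"
    unfolding A_def C_def H_def using sform_Fq[OF subsetD[OF W]] inW by (blast intro: Fq_closed two_Fq)+
  hence dF: "d \<in> Fq q" by (simp add: d_def)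
  have s: "A * sform (comb u v (a, b)) = (A * a + H * b) ^ 2 - d * b ^ 2" for a b
  proof -
    have "bil u v = 2 * H" by (simp add: H_def)
    thus ?thesis by (simp add: comb_def sform_comb A_def[symmetric] C_def[symmetric] d_def
        power2_eq_square algebra_simps)
  qed
  have nz: "sform (comb u v p) \<noteq> 0" if "p \<in> ?D" for p
  proof (rule an)
    show "comb u v p \<in> span2 q u v" using that by (simp add: span2_eq_image)
    show "comb u v p \<noteq> 0" using that comb_eq_0_iff[OF ind, of p] by simp
  qed
  have A0: "A \<noteq> 0" using nz[of "(1, 0)"] unfolding A_def by (simp add: comb_def)
  have sq: "d \<noteq> c * c" if "c \<in> Fq q" for c
  proof
    assume d: "d = c * c"
    have "A * sform (comb u v (c - H, A)) = 0"
      unfolding s d by (simp add: power2_eq_square algebra_simps)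
    moreover have "(c - H, A) \<in> ?D" using that F A0 by auto
    ultimately show False using nz A0 by (metis mult_eq_0_iff)
  qed
  have d0: "d \<noteq> 0" using sq[of 0] by simp
  hence eta: "etaF d = - 1" using etaF_cases[OF dF] etaF_sqrt[OF dF] sq by metis
  define \<phi> where "\<phi> p = ((d * snd p - H * (A * fst p + H * snd p)) / A, A * fst p + H * snd p)" for p
  have s\<phi>: "sform (comb u v (\<phi> p)) = - d * sform (comb u v p)" for p
  proof -
    obtain a b where p: "p = (a, b)" by (cases p)
    have "A * sform (comb u v (\<phi> p)) = (d * b) ^ 2 - d * (A * a + H * b) ^ 2"
      using A0 by (simp add: p \<phi>_def s)
    also have "\<dots> = - d * (A * sform (comb u v p))"
      unfolding p s by (simp add: power2_eq_square algebra_simps)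
    also have "\<dots> = A * (- d * sform (comb u v p))" by simp
    finally show ?thesis using A0 mult_left_cancel by blast
  qed
  show ?thesis
  proof (rule card_positive_of_swap[OF ind W, of \<phi>])
    have rec: "p = p'" if "\<phi> p = \<phi> p'" for p p'
    proof -
      have 1: "A * fst p + H * snd p = A * fst p' + H * snd p'" using that by (simp add: \<phi>_def)
      have "(d * snd p - H * (A * fst p' + H * snd p')) / A = (d * snd p' - H * (A * fst p' + H * snd p')) / A"
        using that unfolding \<phi>_def prod.inject 1 by (rule conjunct1)
      hence "snd p = snd p'" using A0 d0 by simp
      moreover from this have "fst p = fst p'" using 1 A0 by simp
      ultimately show ?thesis by (rule prod_eqI[rotated])
    qed
    thus "inj_on \<phi> ?D" by (meson inj_onI)
    have "\<phi> (0, 0) = (0, 0)" by (simp add: \<phi>_def)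
    hence "\<phi> p \<noteq> (0, 0)" if "p \<noteq> (0, 0)" for p using rec that by metis
    moreover have "\<phi> p \<in> Fq q \<times> Fq q" if "p \<in> Fq q \<times> Fq q" for p
      using that F dF by (simp add: \<phi>_def mem_Times_iff)
    ultimately show into: "\<phi> ` ?D \<subseteq> ?D" by (simp add: image_subset_iff)
    fix p assume p: "p \<in> ?D"
    hence \<phi>p: "\<phi> p \<in> ?D" by (rule subsetD[OF into imageI])
    have c: "chi w = etaF (sform w)" if "sform w \<noteq> 0" for w using that by (cases w) (simp add: chi.simps)
    show "chi (comb u v (\<phi> p)) = - chi (comb u v p)"
      unfolding c[OF nz[OF p]] c[OF nz[OF \<phi>p]] s\<phi>
      by (simp add: etaF_mult etaF_minus eta)
  qed
qed

lemma card_positive_hyperbolic: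
  assumes ind: "lin_indep2 q P R" and W: "span2 q P R \<subseteq> sing"
    and s: "sform P = 0" "sform R = 0" and r: "bil P R \<noteq> 0"
  shows "2 * card (positive (span2 q P R)) = q ^ 2 - 1"
proof -
  let ?D = "Fq q \<times> Fq q - {(0, 0)} :: ('a \<times> 'a) set"
  obtain g where g: "g \<in> Fq q" "g \<noteq> 0" "etaF g = - 1" by (rule nonsquare_Fq)
  have inW: "P \<in> sing" "R \<in> sing" "P + R \<in> sing"
    using subsetD[OF W] span2_basis span2_add[OF span2_basis] by blast+
  hence rF: "bil P R \<in> Fq q" unfolding bil_def using sform_Fq by blast
  have opp: "chi R = - chi P" using chi_opposite inW s rF r by blast
  have c: "chi w = etaF (sform w)" if "sform w \<noteq> 0" for w using that by (cases w) (simp add: chi.simps)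
  have sc: "sform (comb P R (a, b)) = a * b * bil P R" for a b
    by (simp add: comb_def sform_comb s)
  show ?thesis
  proof (rule card_positive_of_swap[OF ind W, of "\<lambda>(a, b). (b, g * a)"])
    show "inj_on (\<lambda>(a, b). (b, g * a)) ?D" using g by (auto simp: inj_on_def)
    show "(\<lambda>(a, b). (b, g * a)) ` ?D \<subseteq> ?D" using g by auto
    fix p assume "p \<in> ?D"
    then obtain a b where p: "p = (a, b)" "a \<in> Fq q" "b \<in> Fq q" "a \<noteq> 0 \<or> b \<noteq> 0" by (cases p) auto
    consider "a = 0" "b \<noteq> 0" | "b = 0" "a \<noteq> 0" | "a \<noteq> 0" "b \<noteq> 0" using p by blast
    thus "chi (comb P R (case p of (a, b) \<Rightarrow> (b, g * a))) = - chi (comb P R p)"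
    proof cases
      case 1
      thus ?thesis using chi_scale inW p opp by (simp add: comb_def)
    next
      case 2
      thus ?thesis using chi_scale inW p opp g by (simp add: comb_def)
    next
      case 3
      hence "sform (comb P R (a, b)) \<noteq> 0" "sform (comb P R (b, g * a)) \<noteq> 0" using g r by (simp_all add: sc)
      thus ?thesis unfolding p prod.case by (simp add: c) (simp add: sc etaF_mult g)
    qed
  qed
qed

lemma card_positive_axis:
  assumes f: "f = (\<lambda>t. (0, t, 0)) \<or> f = (\<lambda>t. (0, 0, t))"
    and ind: "lin_indep2 q (f s) (f t)"
  shows "2 * card (positive (span2 q (f s) (f t))) = q ^ 2 - 1"
proof -
  have inj: "inj f" using f by (auto simp: inj_def)
  have "span2 q (f s) (f t) = range f"
  proof (rule card_seteq)
    show "span2 q (f s) (f t) \<subseteq> range f" using f by (auto simp: span2_def)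
    show "card (range f) \<le> card (span2 q (f s) (f t))"
      using card_span2[OF ind] card_image[OF inj] card_K by simp
  qed simp
  moreover have "positive (range f) = f ` {t \<in> UNIV - {0}. etaK t = 1}"
    using f by (auto simp: positive_def chi.simps sform.simps zero_prod_def)
  moreover have "card (f ` {t \<in> UNIV - {0}. etaK t = 1}) = card {t \<in> UNIV - {0}. etaK t = 1}"
    by (intro card_image inj_on_subset[OF inj]) simp
  moreover have "2 * card {t \<in> UNIV - {0 :: 'a}. etaK t = 1} = card (UNIV - {0 :: 'a})"
    by (rule card_half_of_swap[where \<phi> = "\<lambda>t. \<delta> * t"])
      (auto simp: etaK_mult etaK_delta inj_on_def dest: etaK_cases)
  moreover have "card (UNIV - {0 :: 'a}) = q ^ 2 - 1" by (simp add: card_Diff_singleton card_K)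
  ultimately show ?thesis by simp
qed

theorem card_positive:
  assumes ind: "lin_indep2 q u v" and W: "span2 q u v \<subseteq> sing"
  shows "2 * card (positive (span2 q u v)) = q ^ 2 - 1"
proof (cases "\<forall>w \<in> span2 q u v. w \<noteq> 0 \<longrightarrow> sform w \<noteq> 0")
  case True
  thus ?thesis using card_positive_anisotropic[OF ind W] by blast
next
  case False
  then obtain P where P: "P \<in> span2 q u v" "P \<noteq> 0" "sform P = 0" by blast
  have "q < q ^ 2" by (rule q_form) (simp add: power2_eq_square)
  hence "card (pt q P) < card (span2 q u v)" using card_span2[OF ind] card_pt_le[of P] by simp
  hence "\<not> span2 q u v \<subseteq> pt q P" by (metis card_mono finite linorder_not_less)
  then obtain Q where Q: "Q \<in> span2 q u v" "Q \<notin> pt q P" by blast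
  have indQ: "lin_indep2 q P Q" by (rule lin_indep2_of_notin_pt[OF P(2) Q(2)])
  have spQ: "span2 q P Q = span2 q u v" by (rule span2_change_basis[OF ind P(1) Q(1) indQ])
  have PQ: "P \<in> sing" "Q \<in> sing" "P + Q \<in> sing"
    using subsetD[OF W] P(1) Q(1) span2_add[OF P(1) Q(1)] by blast+
  hence rF: "bil P Q \<in> Fq q" unfolding bil_def using sform_Fq by blast
  show ?thesis
  proof (cases "bil P Q = 0")
    case True
    from degenerate_line_axis[OF PQ(1) P(3) PQ(2) indQ True] show ?thesis
    proof (elim disjE exE conjE)
      fix s t assume "P = (0, s, 0)" "Q = (0, t, 0)"
      thus ?thesis using card_positive_axis[of "\<lambda>t. (0, t, 0)" s t] indQ spQ by simp
    next
      fix s t assume "P = (0, 0, s)" "Q = (0, 0, t)"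
      thus ?thesis using card_positive_axis[of "\<lambda>t. (0, 0, t)" s t] indQ spQ by simp
    qed
  next
    case False
    define c where "c = - sform Q / bil P Q"
    have cF: "c \<in> Fq q" using sform_Fq[OF PQ(2)] rF by (simp add: c_def)
    define R where "R = scale c P + scale 1 Q"
    have R: "R \<in> span2 q u v" unfolding R_def using P Q cF by (intro span2_comb) auto
    have sR: "sform R = 0" unfolding R_def sform_comb using False P(3) by (simp add: c_def)
    have bR: "bil P R = bil P Q"
    proof -
      have "P + R = scale (1 + c) P + scale 1 Q" by (simp add: R_def scale_add_left add.assoc)
      hence "sform (P + R) = (1 + c) * bil P Q + sform Q" using sform_comb[of "1 + c" P 1 Q] P(3) by simp
      thus ?thesis unfolding bil_def[of P R] sR P(3) using False by (simp add: c_def field_simps)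
    qed
    have "R \<notin> pt q P"
    proof
      assume "R \<in> pt q P"
      then obtain a where a: "a \<in> Fq q" "R = scale a P" unfolding pt_def by blast
      have "Q = R + scale (- c) P" by (simp add: R_def scale_uminus_left)
      hence "Q = scale (a - c) P" unfolding a(2) by (simp flip: scale_add_left)
      thus False using Q(2) a(1) cF unfolding pt_def by blast
    qed
    hence indR: "lin_indep2 q P R" by (rule lin_indep2_of_notin_pt[OF P(2)])
    have "span2 q P R = span2 q u v" by (rule span2_change_basis[OF ind P(1) R indR])
    thus ?thesis using card_positive_hyperbolic[OF indR] W P(3) sR bR False by simp
  qed
qed

subsection \<open>The points of positive sign and the orbits\<close>

lemma mem_pt_self: "v \<in> pt q v" for v :: "'a \<times> 'a \<times> 'a"
  unfolding pt_def using scale_1[of v] Fq_closed(2) by (metis (mono_tags, lifting) mem_Collect_eq)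

lemma pt_scale:
  fixes v :: "'a \<times> 'a \<times> 'a"
  assumes c: "c \<in> Fq q" "c \<noteq> 0" shows "pt q (scale c v) = pt q v"
proof (intro equalityI subsetI)
  fix w assume "w \<in> pt q (scale c v)"
  then obtain a where "a \<in> Fq q" "w = scale (a * c) v" by (auto simp: pt_def scale_scale)
  thus "w \<in> pt q v" using c unfolding pt_def by blast
next
  fix w assume "w \<in> pt q v"
  then obtain a where a: "a \<in> Fq q" "w = scale a v" by (auto simp: pt_def)
  hence "w = scale (a / c) (scale c v)" using c by (simp add: scale_scale)
  thus "w \<in> pt q (scale c v)" using c a unfolding pt_def by blast
qed

lemma pt_eq:
  fixes v w :: "'a \<times> 'a \<times> 'a"
  assumes "w \<in> pt q v" "w \<noteq> 0" shows "pt q w = pt q v"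
proof -
  obtain c where c: "c \<in> Fq q" "w = scale c v" using assms(1) unfolding pt_def by blast
  hence "c \<noteq> 0" using assms(2) by auto
  thus ?thesis using pt_scale c by simp
qed

lemma card_pt_minus_zero:
  fixes v :: "'a \<times> 'a \<times> 'a"
  assumes "v \<noteq> 0" shows "card (pt q v - {0}) = q - 1"
proof -
  have "pt q v - {0} = (\<lambda>c. scale c v) ` (Fq q - {0})" using assms by (auto simp: pt_def)
  moreover have "inj_on (\<lambda>c. scale c v) (Fq q - {0})"
  proof (rule inj_onI)
    fix c d assume "scale c v = scale d v"
    hence "scale (c - d) v = 0" using scale_add_left[of c "- d" v] by (simp add: scale_uminus_left)
    thus "c = d" using assms by simp
  qed
  ultimately show ?thesis using card_Fq_units by (simp add: card_image)
qed

definition positive_points :: "('a \<times> 'a \<times> 'a) set set" where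
  "positive_points = pt q ` positive sing"

lemma mem_positive_sing: "v \<in> positive sing \<longleftrightarrow> v \<in> sing \<and> v \<noteq> 0 \<and> chi v = 1"
  by (auto simp: positive_def)

lemma zero_sing: "0 \<in> sing"
  using sing_iff[of 0 0 0] q_gt_0 by (simp add: zero_prod_def power_0_left)

lemma Q_points_eq: "Q_points q = pt q ` (sing - {0})"
  unfolding Q_points_def sing_def by blast

lemma positive_points_subset: "positive_points \<subseteq> Q_points q"
  unfolding positive_points_def Q_points_eq positive_def by blast

lemma Q_points_PG: "Q_points q \<subseteq> (PG_points q :: ('a \<times> 'a \<times> 'a) set set)"
  unfolding Q_points_def PG_points_def by blast

lemma span2_sing_of_line:
  fixes u v :: "'a \<times> 'a \<times> 'a"
  assumes uv: "u \<in> Vsp q" "v \<in> Vsp q"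
    and l: "{P \<in> PG_points q. P \<subseteq> span2 q u v} \<subseteq> Q_points q"
  shows "span2 q u v \<subseteq> sing"
proof
  fix w assume w: "w \<in> span2 q u v"
  obtain a b where "w = scale a u + scale b v" "a \<in> Fq q" "b \<in> Fq q"
    using w unfolding span2_def by blast
  hence wV: "w \<in> Vsp q" using Vsp_add[OF Vsp_scale Vsp_scale] uv by simp
  show "w \<in> sing"
  proof (cases "w = 0")
    case False
    have "pt q w \<subseteq> span2 q u v"
    proof
      fix x assume "x \<in> pt q w"
      then obtain c where c: "c \<in> Fq q" "x = scale c w" by (auto simp: pt_def)
      thus "x \<in> span2 q u v" using span2_comb[OF w w c(1) Fq_closed(1)] by simp
    qed
    hence "pt q w \<in> Q_points q" using l wV False unfolding PG_points_def by blast
    then obtain t where t: "t \<in> sing" "pt q w = pt q t" unfolding Q_points_eq by blast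
    hence "w \<in> pt q t" using mem_pt_self by blast
    thus ?thesis using t(1) sing_scale unfolding pt_def by blast
  qed (simp add: zero_sing)
qed

lemma card_positive_points_line:
  assumes "l \<in> Q_lines q" shows "card (positive_points \<inter> l) = (q + 1) div 2"
proof -
  obtain u v where uv: "u \<in> Vsp q" "v \<in> Vsp q" and ind: "lin_indep2 q u v"
    and l: "l = {P \<in> PG_points q. P \<subseteq> span2 q u v}" and lQ: "l \<subseteq> Q_points q"
    using assms unfolding Q_lines_def PG_lines_def by blast
  let ?W = "span2 q u v"
  have W: "?W \<subseteq> sing" using span2_sing_of_line[OF uv] lQ l by blast
  have pt_sub: "pt q w \<subseteq> ?W" if "w \<in> ?W" for w
  proof
    fix x assume "x \<in> pt q w"
    then obtain c where c: "c \<in> Fq q" "x = scale c w" by (auto simp: pt_def)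
    thus "x \<in> ?W" using span2_comb[OF that that c(1) Fq_closed(1)] by simp
  qed
  have eq: "positive_points \<inter> l = pt q ` positive ?W"
  proof (intro equalityI subsetI)
    fix P assume "P \<in> positive_points \<inter> l"
    then obtain w where w: "w \<in> positive sing" "P = pt q w" "P \<subseteq> ?W" unfolding positive_points_def l by blast
    hence "w \<in> positive ?W" using mem_pt_self[of w] unfolding positive_def by blast
    thus "P \<in> pt q ` positive ?W" using w by blast
  next
    fix P assume "P \<in> pt q ` positive ?W"
    then obtain w where w: "w \<in> positive ?W" "P = pt q w" by blast
    hence "P \<in> positive_points" "w \<in> ?W" using W by (auto simp: positive_points_def positive_def)
    thus "P \<in> positive_points \<inter> l" using positive_points_subset Q_points_PG pt_sub w unfolding l by blast
  qed
  have un: "positive ?W = (\<Union>P \<in> pt q ` positive ?W. P - {0})"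
  proof (intro equalityI subsetI)
    fix w assume "w \<in> positive ?W"
    thus "w \<in> (\<Union>P \<in> pt q ` positive ?W. P - {0})" using mem_pt_self unfolding positive_def by blast
  next
    fix w assume "w \<in> (\<Union>P \<in> pt q ` positive ?W. P - {0})"
    then obtain t where t: "t \<in> positive ?W" "w \<in> pt q t" "w \<noteq> 0" by blast
    then obtain c where c: "c \<in> Fq q" "w = scale c t" by (auto simp: pt_def)
    hence "c \<noteq> 0" using t by auto
    have t': "t \<in> ?W" "chi t = 1" using t(1) unfolding positive_def by blast+
    hence "chi w = 1" using chi_scale[OF subsetD[OF W t'(1)] c(1) \<open>c \<noteq> 0\<close>] c(2) by simp
    moreover have "w \<in> ?W" using pt_sub[OF t'(1)] t(2) by blast
    ultimately show "w \<in> positive ?W" using t(3) by (simp add: positive_def)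
  qed
  have "card (positive ?W) = (\<Sum>P \<in> pt q ` positive ?W. card (P - {0}))"
  proof (subst un, rule card_UN_disjoint)
    show "\<forall>P \<in> pt q ` positive ?W. \<forall>P' \<in> pt q ` positive ?W. P \<noteq> P' \<longrightarrow> (P - {0}) \<inter> (P' - {0}) = {}"
      using pt_eq by blast
  qed simp_all
  also have "\<dots> = (\<Sum>P \<in> pt q ` positive ?W. q - 1)"
    by (rule sum.cong[OF refl]) (auto simp: positive_def card_pt_minus_zero)
  also have "\<dots> = card (positive_points \<inter> l) * (q - 1)" by (simp add: eq)
  finally have "2 * (card (positive_points \<inter> l) * (q - 1)) = q ^ 2 - 1" using card_positive[OF ind W] by simp
  also have "q ^ 2 - 1 = (q + 1) * (q - 1)" by (simp add: power2_eq_square algebra_simps)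
  finally have "(2 * card (positive_points \<inter> l)) * (q - 1) = (q + 1) * (q - 1)" by simp
  moreover have "q - 1 \<noteq> 0" by (rule q_form) simp
  ultimately have "2 * card (positive_points \<inter> l) = q + 1" by (metis mult_cancel2)
  thus ?thesis by simp
qed

lemma pow_q_q: "(x ^ q) ^ q = x" for x :: 'a
proof (cases "x = 0")
  case False
  have "x ^ q ^ 2 = x ^ (q ^ 2 - 1) * x" using q_gt_0 by (metis power_minus_mult zero_less_power)
  thus ?thesis using pow_q2[OF False] by (simp add: power_mult[symmetric] power2_eq_square)
qed (use q_gt_0 in simp)

lemma C0_2: "C0 2 = {u :: 'a. etaK u = 1}"
proof -
  obtain k where k: "q = 4 * k + 1" by (rule q_form)
  have "2 * ((q ^ 2 - 1) div 2) = CARD('a) - 1"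
    unfolding card_K by (simp add: k power2_eq_square algebra_simps)
  from C0_eq_roots_of_unity(1)[OF this] show ?thesis by (simp add: etaK_def)
qed

lemma etaF_1_Fq: assumes "etaF c = 1" shows "c \<in> Fq q"
proof -
  obtain k where k: "q = 4 * k + 1" by (rule q_form)
  have "c \<noteq> 0" using assms etaF_0_iff[of c] by fastforce
  moreover have "c ^ (q - 1) = etaF c * etaF c"
    unfolding etaF_def power_add[symmetric] by (rule arg_cong[where f = "power c"]) (simp add: k)
  ultimately show ?thesis using assms Fq_units by simp
qed

lemma cyc_class_delta:
  "cyc_class \<gamma> (2 * (q + 1)) ((q + 1) div 2) = {\<delta> * c | c. etaF c = 1}"
proof -
  obtain k where k: "q = 4 * k + 1" by (rule q_form)
  have "(2 * (q + 1)) * ((q - 1) div 2) = CARD('a) - 1"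
    unfolding card_K by (simp add: k power2_eq_square algebra_simps)
  from C0_eq_roots_of_unity(1)[OF this] show ?thesis
    by (auto simp: cyc_class_def \<delta>_def etaF_def)
qed

definition lin_gens :: "('a \<times> 'a \<times> 'a \<Rightarrow> 'a \<times> 'a \<times> 'a) set" where
  "lin_gens = {T_map u | u. etaK u = 1} \<union> {sigma_map q, tau_map}"

lemma A_group_eq: "A_group q = generate (BijGroup (PG_points q)) (induced q ` lin_gens)"
proof -
  have "{induced q (T_map u) | u :: 'a. u \<in> C0 2} \<union> {induced q (sigma_map q), induced q tau_map}
      = induced q ` lin_gens"
    unfolding C0_2 lin_gens_def by blast
  thus ?thesis by (simp add: A_group_def)
qed

lemma lin_gens_cases:
  assumes "g \<in> lin_gens"
  obtains u where "g = T_map u" "etaK u = 1" "u \<noteq> 0" | "g = sigma_map q" | "g = tau_map"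
proof -
  have "u \<noteq> 0" if "etaK u = 1" for u using that etaK_0_iff[of u] by fastforce
  thus thesis using assms that unfolding lin_gens_def by blast
qed

lemma etaK_inverse: "etaK u = 1 \<Longrightarrow> etaK (inverse u) = 1"
  by (simp add: etaK_def power_inverse)

lemma lin_gens_scale:
  assumes "g \<in> lin_gens" "c \<in> Fq q" shows "g (scale c v) = scale c (g v)"
  using assms(1)
proof (cases rule: lin_gens_cases)
qed (cases v; use assms(2) in \<open>simp add: power_mult_distrib mem_Fq mult.assoc\<close>)+

lemma lin_gens_Vsp: "g \<in> lin_gens \<Longrightarrow> v \<in> Vsp q \<Longrightarrow> g v \<in> Vsp q"
  by (erule lin_gens_cases; cases v) (simp_all add: Vsp_def)

lemma lin_gens_inverse:
  assumes "g \<in> lin_gens"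
  obtains h where "h \<in> lin_gens" "\<And>v. h (g v) = v" "\<And>v. g (h v) = v"
  using assms
proof (cases rule: lin_gens_cases)
  case (1 u)
  have "T_map (inverse u) \<in> lin_gens" using etaK_inverse[OF 1(2)] by (auto simp: lin_gens_def)
  moreover have "T_map (inverse u) (g v) = v" "g (T_map (inverse u) v) = v" for v
    using 1 by (cases v; simp add: mult.assoc)+
  ultimately show thesis by (rule that)
next
  case 2
  have "g (g v) = v" for v using 2 by (cases v) (simp add: pow_q_q)
  thus thesis using that[of g] assms by simp
next
  case 3
  have "g (g v) = v" for v using 3 by (cases v) simp
  thus thesis using that[of g] assms by simp
qed

lemma lin_gens_nonzero:
  assumes "g \<in> lin_gens" "v \<noteq> 0" shows "g v \<noteq> 0"
proof
  assume g0: "g v = 0"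
  obtain h where h: "h \<in> lin_gens" "\<And>v. h (g v) = v" by (rule lin_gens_inverse[OF assms(1)]) blast
  have "v = h (scale 0 0)" using h(2)[of v] g0 by simp
  also have "\<dots> = 0" using lin_gens_scale[OF h(1), of 0 0] by simp
  finally show False using assms(2) by simp
qed

lemma image_pt:
  assumes "g \<in> lin_gens" shows "g ` pt q v = pt q (g v)"
proof -
  have pt: "pt q w = (\<lambda>c. scale c w) ` Fq q" for w :: "'a \<times> 'a \<times> 'a" by (auto simp: pt_def)
  show ?thesis unfolding pt image_image using lin_gens_scale[OF assms] by simp
qed

lemma mem_PG_points: "v \<in> Vsp q \<Longrightarrow> v \<noteq> 0 \<Longrightarrow> pt q v \<in> PG_points q"
  unfolding PG_points_def by blast

lemma induced_pt:
  assumes "g \<in> lin_gens" "v \<in> Vsp q" "v \<noteq> 0" shows "induced q g (pt q v) = pt q (g v)"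
  using mem_PG_points[OF assms(2,3)] image_pt[OF assms(1)] by (simp add: induced_def)

lemma induced_Bij: assumes "g \<in> lin_gens" shows "induced q g \<in> Bij (PG_points q)"
proof -
  have into: "induced q g ` PG_points q \<subseteq> PG_points q" if "g \<in> lin_gens" for g
  proof
    fix P assume "P \<in> induced q g ` PG_points q"
    then obtain v where v: "v \<in> Vsp q" "v \<noteq> 0" "P = induced q g (pt q v)"
      unfolding PG_points_def by blast
    thus "P \<in> PG_points q"
      using induced_pt[OF that v(1,2)]
        mem_PG_points[OF lin_gens_Vsp[OF that v(1)] lin_gens_nonzero[OF that v(2)]] by simp
  qed
  obtain h where h: "h \<in> lin_gens" "\<And>v. h (g v) = v" "\<And>v. g (h v) = v"
    by (rule lin_gens_inverse[OF assms]) blast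
  have inv: "induced q h (induced q g P) = P"
    if P: "P \<in> PG_points q" and gh: "g \<in> lin_gens" "h \<in> lin_gens" and id: "\<And>v. h (g v) = v" for g h P
  proof -
    obtain v where v: "v \<in> Vsp q" "v \<noteq> 0" "P = pt q v" using P unfolding PG_points_def by blast
    thus ?thesis
      using induced_pt[OF gh(1) v(1,2)] id[of v]
        induced_pt[OF gh(2) lin_gens_Vsp[OF gh(1) v(1)] lin_gens_nonzero[OF gh(1) v(2)]] by simp
  qed
  have "bij_betw (induced q g) (PG_points q) (PG_points q)"
    by (rule bij_betw_byWitness[where f' = "induced q h"])
      (use inv assms h into in auto)
  thus ?thesis by (simp add: Bij_def induced_def)
qed

lemma A_group_Bij: "A_group q \<subseteq> Bij (PG_points q :: ('a \<times> 'a \<times> 'a) set set)"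
proof -
  have "A_group q \<subseteq> carrier (BijGroup (PG_points q :: ('a \<times> 'a \<times> 'a) set set))"
    unfolding A_group_eq by (rule group.generate_incl[OF group_BijGroup])
      (use induced_Bij in \<open>auto simp: BijGroup_def\<close>)
  thus ?thesis by (simp add: BijGroup_def)
qed

lemma A_orbit_self:
  assumes "v \<in> Vsp q" "v \<noteq> 0" shows "pt q v \<in> A_orbit q (v :: 'a \<times> 'a \<times> 'a)"
proof -
  let ?B = "BijGroup (PG_points q :: ('a \<times> 'a \<times> 'a) set set)"
  have "\<one>\<^bsub>?B\<^esub> \<in> A_group q" unfolding A_group_eq by (rule generate.one)
  moreover have "\<one>\<^bsub>?B\<^esub> (pt q v) = pt q v"
    using mem_PG_points[OF assms] by (simp add: BijGroup_def)
  ultimately show ?thesis unfolding A_orbit_def by (metis (mono_tags, lifting) mem_Collect_eq)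
qed

lemma A_orbit_step:
  assumes v: "v \<in> Vsp q" "v \<noteq> 0" and w: "w \<in> Vsp q" "w \<noteq> 0"
    and pw: "pt q w \<in> A_orbit q v" and g: "g \<in> lin_gens"
  shows "pt q (g w) \<in> A_orbit q v"
proof -
  obtain f where f: "f \<in> A_group q" "pt q w = f (pt q v)" using pw unfolding A_orbit_def by blast
  let ?h = "induced q g \<otimes>\<^bsub>BijGroup (PG_points q)\<^esub> f"
  have "?h \<in> A_group q" using f(1) g unfolding A_group_eq
    by (intro generate.eng generate.incl[OF imageI])
  moreover have "?h (pt q v) = pt q (g w)"
    using f subsetD[OF A_group_Bij f(1)] induced_Bij[OF g] mem_PG_points[OF v] induced_pt[OF g w]
    by (simp add: BijGroup_def compose_def)
  ultimately show ?thesis unfolding A_orbit_def by (metis (mono_tags, lifting) mem_Collect_eq)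
qed

lemma lin_gens_positive:
  assumes "g \<in> lin_gens" "v \<in> positive sing" shows "g v \<in> positive sing"
proof -
  obtain x y z where v: "v = (x, y, z)" by (cases v)
  have vs: "v \<in> sing" "v \<noteq> 0" "chi v = 1" using assms(2) by (auto simp: positive_def)
  have xF: "x \<in> Fq q" and f0: "x ^ 2 + y * z + (y * z) ^ q = 0" using vs(1) v sing_iff by auto
  have "g v \<in> sing \<and> chi (g v) = chi v"
    using assms(1)
  proof (cases rule: lin_gens_cases)
    case (1 u)
    have p: "y * u * (z * inverse u) = y * z" using 1 by simp
    have "sform (x, y * u, z * inverse u) = sform (x, y, z)" unfolding sform.simps p ..
    moreover have "g v \<in> sing" unfolding 1 v T_map.simps sing_iff p using xF f0 by simp
    ultimately show ?thesis
      using 1 etaK_inverse[of u] by (simp add: v chi.simps etaK_mult)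
  next
    case 2
    have "sform (x, y, z) ^ q = ((y * z) ^ q + x ^ 2 / 2) / - \<delta>"
    proof -
      have "x ^ 2 / 2 \<in> Fq q" using xF by simp
      thus ?thesis unfolding sform.simps power_divide[of _ \<delta>] frobenius_add delta_frobenius mem_Fq by simp
    qed
    moreover have "sform (x, y, z) ^ q = sform (x, y, z)" using sform_Fq[OF vs(1)] v by (simp add: mem_Fq)
    ultimately have "sform (x, y ^ q, z ^ q) = - sform (x, y, z)"
      by (simp add: sform.simps[of x "y ^ q"] power_mult_distrib)
    moreover have "etaK (t ^ q) = etaK t" for t
    proof -
      have "etaK (t ^ q) = etaK t ^ q" by (simp add: etaK_def mult.commute flip: power_mult)
      moreover have "odd q" using q_mod_4 by presburger
      ultimately show ?thesis using etaK_cases[of t] q_gt_0 by (cases "t = 0") (auto simp: etaK_0_iff[THEN iffD2])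
    qed
    moreover have "g v \<in> sing"
      unfolding 2 v sigma_map.simps sing_iff power_mult_distrib[symmetric] pow_q_q
      using xF f0 by (simp add: add_ac)
    ultimately show ?thesis using 2 q_gt_0 by (simp add: v chi.simps etaF_minus)
  next
    case 3
    have s: "sform (x, z, y) = sform (x, y, z)" by (simp add: sform.simps mult.commute)
    have "g v \<in> sing" unfolding 3 v tau_map.simps sing_iff using xF f0 by (simp add: mult.commute)
    moreover have "chi (x, z, y) = chi (x, y, z)"
      using s chi_zero_z[of x y z] vs(1) v by (cases "sform (x, y, z) = 0"; cases "z = 0") (auto simp: chi.simps)
    ultimately show ?thesis using 3 v by simp
  qed
  thus ?thesis using vs lin_gens_nonzero[OF assms(1)] by (simp add: mem_positive_sing)
qed

lemma A_orbit_subset: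
  assumes "v \<in> positive sing" shows "A_orbit q v \<subseteq> positive_points"
proof -
  let ?H = "{f \<in> Bij (PG_points q). f ` positive_points \<subseteq> positive_points}"
  have "subgroup ?H (BijGroup (PG_points q))"
    by (rule subgroup_BijGroup_stabilizer) (use positive_points_subset Q_points_PG in auto)
  moreover have "induced q ` lin_gens \<subseteq> ?H"
  proof clarify
    fix g assume g: "g \<in> lin_gens"
    have "induced q g (pt q w) \<in> positive_points" if "w \<in> positive sing" for w
    proof -
      have "w \<in> Vsp q" "w \<noteq> 0" using that by (auto simp: positive_def sing_def)
      thus ?thesis using induced_pt[OF g] lin_gens_positive[OF g that] by (simp add: positive_points_def)
    qed
    thus "induced q g \<in> Bij (PG_points q) \<and> induced q g ` positive_points \<subseteq> positive_points"
      using induced_Bij[OF g] by (auto simp: positive_points_def)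
  qed
  ultimately have "A_group q \<subseteq> ?H"
    unfolding A_group_eq by (intro group.generate_subgroup_incl[OF group_BijGroup])
  moreover have "pt q v \<in> positive_points" using assms by (simp add: positive_points_def)
  ultimately show ?thesis unfolding A_orbit_def by blast
qed

lemma base_points_positive:
  "(0, 0, 1) \<in> positive sing" "(1, 1, - 1 / 2) \<in> positive sing" "(0, 1, \<delta>) \<in> positive sing"
proof -
  have [simp]: "etaK 1 = 1" "etaF 1 = 1" by (simp_all add: etaK_def etaF_def)
  have "(- 1 / 2 :: 'a) ^ q = - 1 / 2" using Fq_closed(6,7)[of 1] by (simp add: mem_Fq[symmetric])
  moreover have "1 + (- 1 / 2) + (- 1 / 2) = (0 :: 'a)" by (simp add: field_simps)
  ultimately show "(1, 1, - 1 / 2) \<in> positive sing"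
    by (simp add: mem_positive_sing sing_iff zero_prod_def chi.simps sform.simps)
  show "(0, 0, 1) \<in> positive sing" "(0, 1, \<delta>) \<in> positive sing"
    using q_gt_0 by (simp_all add: mem_positive_sing sing_iff zero_prod_def chi.simps sform.simps delta_frobenius)
qed

lemma S_set_subset: "S_set q \<gamma> \<subseteq> positive_points"
proof
  fix P assume "P \<in> S_set q \<gamma>"
  then obtain c y where c: "etaF c = 1" "y \<noteq> 0" "P = pt q (1, y, inverse y * (\<delta> * c - 1 / 2))"
    unfolding S_set_def cyc_class_delta by blast
  have cF: "c \<in> Fq q" using c(1) by (rule etaF_1_Fq)
  have c0: "c \<noteq> 0" using c(1) etaF_0_iff[of c] by fastforce
  let ?z = "inverse y * (\<delta> * c - 1 / 2)"
  have p: "y * ?z = \<delta> * c - 1 / 2" using c(2) by simp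
  have s: "sform (1, y, ?z) = c" unfolding sform.simps p by simp
  have "(1 / 2 :: 'a) ^ q = 1 / 2" unfolding mem_Fq[symmetric] by simp
  hence "(\<delta> * c - 1 / 2) ^ q = - (\<delta> * c) - 1 / 2"
    using cF by (simp add: frobenius_diff power_mult_distrib delta_frobenius mem_Fq)
  moreover have "1 + (\<delta> * c - 1 / 2) + (- (\<delta> * c) - 1 / 2) = 0" by (simp add: field_simps)
  ultimately have "(1, y, ?z) \<in> sing" unfolding sing_iff p by simp
  moreover have "chi (1, y, ?z) = 1" unfolding chi.simps s using c0 c(1) by simp
  ultimately have "(1, y, ?z) \<in> positive sing" by (simp add: mem_positive_sing zero_prod_def)
  thus "P \<in> positive_points" unfolding positive_points_def c(3) by (rule imageI)
qed

lemma positive_points_cases: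
  assumes "v \<in> positive sing"
  shows "pt q v \<in> A_orbit q (0, 0, 1) \<union> A_orbit q (1, 1, - 1 / 2) \<union> A_orbit q (0, 1, \<delta>) \<union> S_set q \<gamma>"
    (is "_ \<in> ?M")
proof -
  have Vsp: "w \<in> Vsp q" "w \<noteq> 0" if "w \<in> positive sing" for w
    using that by (auto simp: positive_def sing_def)
  have Tmem: "T_map u \<in> lin_gens" if "etaK u = 1" for u using that by (auto simp: lin_gens_def)
  have T: "pt q (T_map u w) \<in> A_orbit q w" if "w \<in> positive sing" "etaK u = 1" for u w
    using A_orbit_step[OF Vsp[OF that(1)] Vsp[OF that(1)] A_orbit_self[OF Vsp[OF that(1)]] Tmem[OF that(2)]] .
  have TT: "pt q (tau_map (T_map u w)) \<in> A_orbit q w" if "w \<in> positive sing" "etaK u = 1" for u w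
    using A_orbit_step[OF Vsp[OF that(1)] Vsp[OF lin_gens_positive[OF Tmem[OF that(2)] that(1)]] T[OF that], of tau_map]
    by (simp add: lin_gens_def)
  obtain x y z where v: "v = (x, y, z)" by (cases v)
  have vs: "v \<in> sing" "v \<noteq> 0" "chi v = 1" using assms by (auto simp: positive_def)
  have xF: "x \<in> Fq q" using vs(1) v sing_iff by auto
  define s where "s = sform v"
  have sF: "s \<in> Fq q" using sform_Fq[OF vs(1)] s_def by simp
  have yz: "y * z = \<delta> * s - x ^ 2 / 2" using sform_eq[of y z x] v s_def by simp
  have eF: "etaF s = 1" if "s \<noteq> 0" using that vs(3) v s_def by (simp add: chi.simps)
  consider "x \<noteq> 0" "s \<noteq> 0" | "x \<noteq> 0" "s = 0" | "x = 0" "s \<noteq> 0" | "x = 0" "s = 0" by blast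
  thus ?thesis
  proof cases
    case 1
    have y: "y \<noteq> 0"
    proof
      assume "y = 0"
      hence "\<delta> * s = x ^ 2 / 2" using yz by simp
      moreover have "etaK (x ^ 2 / 2) = 1" using 1 xF by (intro etaK_Fq) auto
      ultimately have "etaK (\<delta> * s) = 1" by (simp only:)
      thus False using etaK_delta_mult[OF sF 1(2)] by simp
    qed
    define c where "c = s / (x * x)"
    have "etaF (c * (x * x)) = 1" using eF 1 by (simp add: c_def)
    hence c: "etaF c = 1" using etaF_square[OF xF 1(1)] by (simp add: etaF_mult)
    have "pt q v = pt q (scale (inverse x) v)" by (rule pt_scale[symmetric]) (use xF 1 in auto)
    also have "scale (inverse x) v = (1, y / x, inverse (y / x) * (\<delta> * c - 1 / 2))"
    proof -
      have "z = (\<delta> * s - x ^ 2 / 2) / y" unfolding yz[symmetric] using y by simp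
      moreover have "inverse x * (k / y) = inverse (y / x) * (k / (x * x))" for k
        using 1 y by (simp add: field_simps)
      ultimately have "inverse x * z = inverse (y / x) * ((\<delta> * s - x ^ 2 / 2) / (x * x))" by (simp only:)
      also have "(\<delta> * s - x ^ 2 / 2) / (x * x) = \<delta> * c - 1 / 2"
        using 1 by (simp add: c_def diff_divide_distrib power2_eq_square)
      finally have "inverse x * z = inverse (y / x) * (\<delta> * c - 1 / 2)" .
      moreover have "inverse x * y = y / x" by (simp add: field_simps)
      ultimately show ?thesis using 1 by (simp only: v scale.simps left_inverse not_False_eq_True)
    qed
    also have "pt q \<dots> \<in> S_set q \<gamma>"
      unfolding S_set_def cyc_class_delta using c y 1 by (intro CollectI exI[of _ "\<delta> * c"] exI[of _ "y / x"]) auto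
    finally show ?thesis by blast
  next
    case 2
    have y: "y \<noteq> 0" using yz 2 by auto
    have ey: "etaK y = 1" using 2 y vs(3) v s_def by (simp add: chi.simps)
    have e: "etaK (y / x) = 1" using ey 2 xF etaK_Fq[of "inverse x"] by (simp add: divide_inverse etaK_mult)
    have "pt q v = pt q (scale (inverse x) v)" by (rule pt_scale[symmetric]) (use xF 2 in auto)
    also have "scale (inverse x) v = T_map (y / x) (1, 1, - 1 / 2)"
    proof -
      have yz': "y * z = (- 1 / 2) * (x * x)" using yz 2 by (simp add: power2_eq_square)
      have "z = (- 1 / 2) * (x * x) / y" unfolding yz'[symmetric] using y by simp
      moreover have "inverse x * (k * (x * x) / y) = k * inverse (y / x)" for k
        using 2 y by (simp add: field_simps)
      ultimately have "inverse x * z = (- 1 / 2) * inverse (y / x)" by (simp only:)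
      moreover have "inverse x * y = 1 * (y / x)" by (simp add: field_simps)
      ultimately show ?thesis using 2
        by (simp only: v scale.simps T_map.simps left_inverse not_False_eq_True)
    qed
    also have "pt q \<dots> \<in> ?M" using T[OF base_points_positive(2) e] by blast
    finally show ?thesis .
  next
    case 3
    obtain c where c: "c \<in> Fq q" "c \<noteq> 0" "s = c * c" using etaF_sqrt[OF sF eF[OF 3(2)]] .
    have ab: "(y / c) * (z / c) = \<delta>" using yz 3 c by (simp add: field_simps)
    have "pt q v = pt q (scale (inverse c) v)" by (rule pt_scale[symmetric]) (use c in auto)
    also have "scale (inverse c) v = (0, y / c, z / c)" using 3 by (simp add: v divide_inverse mult.commute)
    finally have pv: "pt q v = pt q (0, y / c, z / c)" .
    have nz: "y / c \<noteq> 0" "z / c \<noteq> 0" using ab by auto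
    have "etaK (y / c) = - etaK (z / c)" using ab etaK_delta by (intro etaK_prod_minus) simp
    then consider "etaK (y / c) = 1" | "etaK (z / c) = 1" using etaK_cases[OF nz(2)] by fastforce
    thus ?thesis
    proof cases
      case 1
      have "(0, y / c, z / c) = T_map (y / c) (0, 1, \<delta>)" unfolding ab[symmetric] using nz by simp
      thus ?thesis unfolding pv using T[OF base_points_positive(3) 1] by simp
    next
      case 2
      have "(0, y / c, z / c) = tau_map (T_map (z / c) (0, 1, \<delta>))" unfolding ab[symmetric] using nz by simp
      thus ?thesis unfolding pv using TT[OF base_points_positive(3) 2] by simp
    qed
  next
    case 4
    consider "y = 0" "z \<noteq> 0" | "z = 0" "y \<noteq> 0" using yz 4 vs(2) v by (auto simp: zero_prod_def)
    thus ?thesis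
    proof cases
      case 1
      hence "etaK z = 1" using 4 vs(3) v s_def by (simp add: chi.simps)
      moreover have "v = T_map (inverse z) (0, 0, 1)" using 4 1 v by simp
      ultimately show ?thesis using T[OF base_points_positive(1) etaK_inverse] by simp
    next
      case 2
      hence "etaK y = 1" using 4 vs(3) v s_def by (simp add: chi.simps)
      moreover have "v = tau_map (T_map (inverse y) (0, 0, 1))" using 4 2 v by simp
      ultimately show ?thesis using TT[OF base_points_positive(1) etaK_inverse] by simp
    qed
  qed
qed

theorem m_ovoid_union:
  "m_ovoid q ((q + 1) div 2)
    (A_orbit q (0, 0, 1) \<union> A_orbit q (1, 1, - 1 / 2) \<union> A_orbit q (0, 1, \<delta>) \<union> S_set q \<gamma>)"
  (is "m_ovoid _ _ ?M")
proof -
  have "?M = positive_points"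
  proof
    show "?M \<subseteq> positive_points" using A_orbit_subset base_points_positive S_set_subset by simp
    show "positive_points \<subseteq> ?M" using positive_points_cases unfolding positive_points_def by blast
  qed
  moreover have "(q + 1) div 2 > 0" using q_gt_0 by simp
  ultimately show ?thesis unfolding m_ovoid_def using positive_points_subset card_positive_points_line by simp
qed

end

theorem theorem5:
  fixes q :: nat and \<gamma> \<delta> :: "'a::{field,finite}"
    and M :: "('a \<times> 'a \<times> 'a) set set"
  assumes "primepow q" and "q mod 4 = 1"
    and "CARD('a) = q ^ 2"
    and "primitive_elt \<gamma>"
    and "\<delta> = \<gamma> ^ ((q + 1) div 2)"
    and "M = A_orbit q (0, 0, 1) \<union> A_orbit q (1, 1, - 1 / 2) \<union> A_orbit q (0, 1, \<delta>) \<union> S_set q \<gamma>"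
  shows "m_ovoid q ((q + 1) div 2) M"
proof -
  interpret quadric_setting q \<gamma> using assms(1-4) by unfold_locales
  show ?thesis using m_ovoid_union unfolding assms(5,6) \<delta>_def .
qed

end
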